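(* Let $q$ be a power of a prime number (with positive exponent), $q\neq 2,3,5$, and let $G=\mathrm{PSL}(2,q)$. Then $$\kappa(G)=\begin{cases} q^2+q+1 & \text{if } q\equiv 0 \bmod 4,\\ q+\frac{(q-1)q}{2}+2 & \text{if } q\equiv 1\bmod 4,\\ q+\frac{(q+1)q}{2}+2 & \text{if } q\equiv 3\bmod 4.\end{cases}$$
   Context: $\mathrm{PSL}(2,q)$ is the projective special linear group of degree two over the field with $q$ elements. For a finite group $G$, $\mathrm{nil}(G)=\{g\in G:\langle g,h\rangle \text{ is nilpotent for all } h\in G\}$. For a finite non-nilpotent group $G$, the nilpotent graph $\Gamma_{\mathfrak N}(G)$ is the simple undirected graph with vertex set $G-\mathrm{nil}(G)$ (set difference) in which two distinct vertices $g,h$ are adjacent if and only if $\langle g,h\rangle$ is nilpotent. $\kappa(G)$ denotes the number of connected components of $\Gamma_{\mathfrak N}(G)$. *)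

theory Defs
  imports
    "HOL-Analysis.Determinants"
    "HOL-Number_Theory.Prime_Powers"
    "HOL-Algebra.Generated_Groups"
    "Graph_Theory.Digraph_Component"
begin

section \<open>Nilpotent groups\<close>

text \<open>
  The lower central series of \<open>G\<close>: each term is generated by the commutators of the elements
  of the preceding term with those of \<open>G\<close>.
\<close>

primrec lower_central :: "('a, 'b) monoid_scheme \<Rightarrow> nat \<Rightarrow> 'a set" where
  "lower_central G 0 = carrier G"
| "lower_central G (Suc n) =
     generate G (\<Union>x \<in> lower_central G n. \<Union>y \<in> carrier G.
       {x \<otimes>\<^bsub>G\<^esub> y \<otimes>\<^bsub>G\<^esub> inv\<^bsub>G\<^esub> x \<otimes>\<^bsub>G\<^esub> inv\<^bsub>G\<^esub> y})"

definition nilpotent_group :: "('a, 'b) monoid_scheme \<Rightarrow> bool" where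
  "nilpotent_group G \<longleftrightarrow> group G \<and> (\<exists>n. lower_central G n = {\<one>\<^bsub>G\<^esub>})"


section \<open>The nilpotent graph of a group\<close>

abbreviation generated_subgroup ::
    "('a, 'b) monoid_scheme \<Rightarrow> 'a set \<Rightarrow> ('a, 'b) monoid_scheme" where
  "generated_subgroup G S \<equiv> G \<lparr>carrier := generate G S\<rparr>"

definition nil :: "('a, 'b) monoid_scheme \<Rightarrow> 'a set" where
  "nil G = {g \<in> carrier G. \<forall>h \<in> carrier G. nilpotent_group (generated_subgroup G {g, h})}"

text \<open>
  A simple undirected graph is represented as a symmetric loop-free digraph without parallel
  arcs (the locale \<^locale>\<open>pair_graph\<close>), so that its connected components are its strongly
  connected components.
\<close>

definition nilpotent_graph :: "('a, 'b) monoid_scheme \<Rightarrow> 'a pair_pre_digraph" where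
  "nilpotent_graph G =
     \<lparr>pverts = carrier G - nil G,
      parcs = {(g, h). g \<in> carrier G - nil G \<and> h \<in> carrier G - nil G \<and> g \<noteq> h \<and>
                       nilpotent_group (generated_subgroup G {g, h})}\<rparr>"

lemma pair_graph_nilpotent_graph:
  assumes "finite (carrier G)"
  shows "pair_graph (nilpotent_graph G)"
proof
  show "finite (parcs (nilpotent_graph G))"
    by (rule finite_subset[of _ "carrier G \<times> carrier G"])
      (use assms in \<open>auto simp: nilpotent_graph_def\<close>)
qed (use assms in \<open>auto simp: nilpotent_graph_def symmetric_def sym_def insert_commute\<close>)

definition kappa :: "('a, 'b) monoid_scheme \<Rightarrow> nat" where
  "kappa G = card (pre_digraph.sccs (with_proj (nilpotent_graph G)))"


section \<open>Projective special linear groups\<close>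

definition group_center :: "('a, 'b) monoid_scheme \<Rightarrow> 'a set" where
  "group_center G = {z \<in> carrier G. \<forall>g \<in> carrier G. z \<otimes>\<^bsub>G\<^esub> g = g \<otimes>\<^bsub>G\<^esub> z}"

lemma (in group) group_center_normal: "group_center G \<lhd> G"
proof (rule normal_invI)
  have closed: "z \<in> carrier G" if "z \<in> group_center G" for z
    using that unfolding group_center_def by blast
  have comm: "z \<otimes> g = g \<otimes> z" if "z \<in> group_center G" "g \<in> carrier G" for z g
    using that unfolding group_center_def by blast
  have centerI: "z \<in> group_center G"
    if "z \<in> carrier G" "\<And>g. g \<in> carrier G \<Longrightarrow> z \<otimes> g = g \<otimes> z" for z
    using that unfolding group_center_def by blast
  show "subgroup (group_center G) G"
  proof (rule subgroupI)
    show "group_center G \<subseteq> carrier G" using closed by blast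
    have "\<one> \<in> group_center G" by (rule centerI) simp_all
    then show "group_center G \<noteq> {}" by blast
    show "inv a \<in> group_center G" if a: "a \<in> group_center G" for a
    proof (rule centerI)
      show "inv a \<otimes> g = g \<otimes> inv a" if g: "g \<in> carrier G" for g
      proof -
        have "inv (inv g \<otimes> a) = inv (a \<otimes> inv g)"
          by (simp only: comm[OF a inv_closed[OF g]])
        then show ?thesis using closed[OF a] g by (simp add: inv_mult_group)
      qed
    qed (use a closed in simp)
    show "a \<otimes> b \<in> group_center G" if a: "a \<in> group_center G" and b: "b \<in> group_center G" for a b
    proof (rule centerI)
      show "a \<otimes> b \<otimes> g = g \<otimes> (a \<otimes> b)" if g: "g \<in> carrier G" for g
      proof -
        have "a \<otimes> b \<otimes> g = a \<otimes> (g \<otimes> b)"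
          using closed[OF a] closed[OF b] g by (simp only: m_assoc comm[OF b g])
        also have "\<dots> = g \<otimes> a \<otimes> b"
          using closed[OF a] closed[OF b] g by (simp only: m_assoc[symmetric] comm[OF a g])
        also have "\<dots> = g \<otimes> (a \<otimes> b)"
          using closed[OF a] closed[OF b] g by (simp only: m_assoc)
        finally show ?thesis .
      qed
    qed (use a b closed in simp)
  qed
  show "x \<otimes> h \<otimes> inv x \<in> group_center G"
    if x: "x \<in> carrier G" and h: "h \<in> group_center G" for x h
  proof -
    have "x \<otimes> h \<otimes> inv x = h \<otimes> x \<otimes> inv x"
      by (simp only: comm[OF h x])
    also have "\<dots> = h"
      using closed[OF h] x by (simp add: m_assoc)
    finally show ?thesis using h by simp
  qed
qed

definition SL :: "('a::field ^ 'n ^ 'n) monoid" where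
  "SL = \<lparr>carrier = {A. det A = 1}, mult = (**), one = mat 1\<rparr>"

lemma group_SL: "group (SL :: ('a::field ^ 'n ^ 'n) monoid)"
proof (rule groupI)
  fix A :: "'a ^ 'n ^ 'n"
  assume "A \<in> carrier SL"
  then have A: "det A = 1" by (simp add: SL_def)
  then obtain B where B: "A ** B = mat 1" "B ** A = mat 1"
    using invertible_det_nz[of A] by (auto simp: invertible_def)
  have "det B = 1" using det_mul[of A B] A B by simp
  then show "\<exists>C \<in> carrier SL. C \<otimes>\<^bsub>SL\<^esub> A = \<one>\<^bsub>SL\<^esub>"
    using B by (auto simp: SL_def)
qed (auto simp: SL_def det_mul matrix_mul_assoc)

definition PSL :: "('a::field ^ 'n ^ 'n) set monoid" where
  "PSL = SL Mod group_center SL"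

lemma group_PSL: "group (PSL :: ('a::field ^ 'n ^ 'n) set monoid)"
  unfolding PSL_def
  by (rule normal.factorgroup_is_group[OF group.group_center_normal[OF group_SL]])

end

theory Submission
  imports Defs "HOL-Computational_Algebra.Polynomial"
begin

text \<open>
  A nilpotent group has a nontrivial center unless it is trivial. So if \<open>g\<close> and \<open>h\<close> generate a
  nilpotent group, then they are joined by a path in the commuting graph on the nonidentity
  elements, and commuting elements generate an abelian, hence nilpotent group. The task is thus to
  count the components of the commuting graph of \<open>PSL(2, q)\<close> (\<open>kappa_eq_card_invariant\<close>).

  Represent the elements by matrices of determinant one, up to sign. Two classes commute if and
  only if their matrices commute or anticommute. A nonscalar matrix commutes precisely with the
  matrices in the plane spanned by it and the identity. These planes are the points of the
  projective plane over the field, obtained by dividing out the scalars from the space of all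
  matrices (\<open>commute_iff_same_point\<close>). Every one of the \<open>q\<^sup>2 + q + 1\<close> points occurs, which settles
  even \<open>q\<close>, where anticommuting means commuting.

  For odd \<open>q\<close>, anticommuting matrices have trace zero, that is, they represent involutions. So only
  the points of involutions can be merged with each other, and they all are: commuting of
  involutions connects any two of them. To see this, describe an involution by its fixed points
  \<open>x \<plusminus> i y\<close> with \<open>i\<^sup>2 = - 1\<close>. Then \<open>(x, y)\<close> and \<open>(x', y')\<close> commute if \<open>(x - x')\<^sup>2 + y\<^sup>2 + y'\<^sup>2 = 0\<close>.
  If \<open>q \<equiv> 1 (mod 4)\<close>, the involution that fixes \<open>x\<close> and infinity commutes with all \<open>(x, y)\<close>, and a
  representation of \<open>- 1\<close> as a sum of two nonzero squares, which exists for \<open>q > 5\<close>, leads from \<open>x\<close>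
  to any other \<open>x'\<close> (\<open>involutions_connected_1_mod_4\<close>). If \<open>q \<equiv> 3 (mod 4)\<close>, the value
  \<open>- (t\<^sup>2 + c\<^sup>2)\<close> is a square for more than half of all \<open>t\<close>, and two such majorities always meet
  (\<open>involutions_connected_3_mod_4\<close>).

  Hence \<open>\<kappa> = q\<^sup>2 + q + 1 - s + 1\<close>, where \<open>s\<close> is the number of involutions. Counting the solutions of
  \<open>a\<^sup>2 + b c = - 1\<close> up to sign gives \<open>s = q (q + 1) / 2\<close> or \<open>s = q (q - 1) / 2\<close> according to whether
  \<open>- 1\<close> is a square or not (\<open>card_involution_points\<close>).
\<close>

section \<open>From the nilpotent graph to the commuting graph\<close>

lemma (in group) commutes_with_generate:
  assumes "S \<subseteq> carrier G" and "z \<in> carrier G"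
    and "\<And>s. s \<in> S \<Longrightarrow> z \<otimes> s = s \<otimes> z"
    and "x \<in> generate G S"
  shows "z \<otimes> x = x \<otimes> z"
  using assms(4)
proof (induction rule: generate.induct)
  case one
  show ?case using assms(2) by simp
next
  case (incl h)
  then show ?case by (rule assms(3))
next
  case (inv h)
  then have h: "h \<in> carrier G" using assms(1) by blast
  have "inv h \<otimes> (z \<otimes> h) \<otimes> inv h = inv h \<otimes> (h \<otimes> z) \<otimes> inv h"
    using assms(3)[OF inv] by simp
  then show ?case using h assms(2) by (simp add: m_assoc inv_solve_left inv_solve_right)
next
  case (eng h1 h2)
  have c: "h1 \<in> carrier G" "h2 \<in> carrier G"
    using eng.hyps generate_in_carrier[OF assms(1)] by blast+
  have "z \<otimes> (h1 \<otimes> h2) = h1 \<otimes> (z \<otimes> h2)"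
    using eng.IH(1) c assms(2) by (simp add: m_assoc[symmetric])
  then show ?case using eng.IH(2) c assms(2) by (simp add: m_assoc)
qed

lemma (in group) comm_group_generated_by_commuting_pair:
  assumes g: "g \<in> carrier G" and h: "h \<in> carrier G" and gh: "g \<otimes> h = h \<otimes> g"
  shows "comm_group (generated_subgroup G {g, h})"
proof -
  have S: "{g, h} \<subseteq> carrier G" using g h by blast
  note carr = generate_in_carrier[OF S]
  have gen: "x \<otimes> s = s \<otimes> x" if "s \<in> {g, h}" "x \<in> generate G {g, h}" for s x
  proof -
    have "s \<otimes> x = x \<otimes> s"
      by (rule commutes_with_generate[OF S _ _ that(2)]) (use that gh g h in auto)
    then show ?thesis by simp
  qed
  have "x \<otimes> y = y \<otimes> x" if "x \<in> generate G {g, h}" "y \<in> generate G {g, h}" for x y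
    using commutes_with_generate[OF S carr[OF that(1)] gen[OF _ that(1)] that(2)] .
  moreover have "group (generated_subgroup G {g, h})"
    by (rule subgroup.subgroup_is_group[OF generate_is_subgroup[OF S] is_group])
  ultimately show ?thesis
    by (intro group.group_comm_groupI) auto
qed

lemma comm_group_imp_nilpotent_group:
  fixes H (structure)
  assumes "comm_group H"
  shows "nilpotent_group H"
proof -
  interpret comm_group H by fact
  have "x \<otimes> y \<otimes> inv x \<otimes> inv y = \<one>" if "x \<in> carrier H" "y \<in> carrier H" for x y
    using that m_comm[of x y] by (simp add: m_assoc)
  then have "(\<Union>x \<in> carrier H. \<Union>y \<in> carrier H. {x \<otimes> y \<otimes> inv x \<otimes> inv y}) \<subseteq> {\<one>}" by auto
  then have "lower_central H (Suc 0) \<subseteq> {\<one>}"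
    by (simp add: generate_subgroup_incl[OF _ triv_subgroup])
  moreover have "\<one> \<in> lower_central H (Suc 0)"
    by (simp add: generate.one)
  ultimately have "lower_central H (Suc 0) = {\<one>}" by blast
  then show ?thesis unfolding nilpotent_group_def using is_group by blast
qed

text \<open>
  The last nontrivial term of the lower central series is central, since its commutators with
  \<open>H\<close> generate the next term, which is trivial.
\<close>
lemma nilpotent_group_nontrivial_center:
  fixes H (structure)
  assumes "nilpotent_group H" and "carrier H \<noteq> {\<one>}"
  obtains z where "z \<in> group_center H" and "z \<noteq> \<one>"
proof -
  interpret group H using assms(1) by (simp add: nilpotent_group_def)
  define n where "n = (LEAST n. lower_central H n = {\<one>})"
  have n: "lower_central H n = {\<one>}"
    unfolding n_def using assms(1) by (metis (mono_tags, lifting) LeastI nilpotent_group_def)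
  then obtain m where m: "n = Suc m"
    using assms(2) by (cases n) auto
  have sub: "lower_central H k \<subseteq> carrier H" for k
  proof (induction k)
    case (Suc k)
    have "generate H (\<Union>x \<in> lower_central H k. \<Union>y \<in> carrier H. {x \<otimes> y \<otimes> inv x \<otimes> inv y})
        \<subseteq> carrier H"
      by (rule generate_incl) (use Suc in auto)
    then show ?case by simp
  qed simp
  have "\<one> \<in> lower_central H m"
    by (cases m) (simp_all add: generate.one)
  moreover have "lower_central H m \<noteq> {\<one>}"
    using not_less_Least[of m "\<lambda>n. lower_central H n = {\<one>}"] m unfolding n_def by simp
  ultimately obtain z where z: "z \<in> lower_central H m" "z \<noteq> \<one>" by blast
  have "z \<otimes> y = y \<otimes> z" if y: "y \<in> carrier H" for y
  proof -
    have zc: "z \<in> carrier H" using z sub by blast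
    have "z \<otimes> y \<otimes> inv z \<otimes> inv y \<in> lower_central H (Suc m)"
      using z(1) y by (auto intro!: generate.incl)
    then have "z \<otimes> y \<otimes> inv z \<otimes> inv y = \<one>" using n m by auto
    then have "z \<otimes> y \<otimes> inv (y \<otimes> z) = \<one>"
      using zc y by (simp add: inv_mult_group m_assoc)
    then show ?thesis using zc y
      by (metis inv_closed inv_equality inv_inv m_closed)
  qed
  then have "z \<in> group_center H" using z sub by (auto simp: group_center_def)
  then show thesis using that z by blast
qed

definition commuting_rel :: "('a, 'b) monoid_scheme \<Rightarrow> 'a rel" where
  "commuting_rel G = {(g, h). g \<in> carrier G - {\<one>\<^bsub>G\<^esub>} \<and> h \<in> carrier G - {\<one>\<^bsub>G\<^esub>} \<and>
     g \<otimes>\<^bsub>G\<^esub> h = h \<otimes>\<^bsub>G\<^esub> g}"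

text \<open>
  A nontrivial central element of \<open>\<langle>g, h\<rangle>\<close> commutes with both \<open>g\<close> and \<open>h\<close>. Hence an edge of the
  nilpotent graph becomes a path of length two in the commuting graph.
\<close>
lemma (in group) nilpotent_pair_imp_commuting_chain:
  assumes g: "g \<in> carrier G - {\<one>}" and h: "h \<in> carrier G - {\<one>}"
    and nilp: "nilpotent_group (generated_subgroup G {g, h})"
  obtains z where "(g, z) \<in> commuting_rel G" and "(z, h) \<in> commuting_rel G"
proof -
  have S: "{g, h} \<subseteq> carrier G" using g h by blast
  have gen: "g \<in> generate G {g, h}" "h \<in> generate G {g, h}" by (auto intro: generate.incl)
  then have "carrier (generated_subgroup G {g, h}) \<noteq> {\<one>\<^bsub>generated_subgroup G {g, h}\<^esub>}"
    using g by auto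
  from nilpotent_group_nontrivial_center[OF nilp this]
  obtain z where "z \<in> group_center (generated_subgroup G {g, h})" "z \<noteq> \<one>" by auto
  then show thesis
    using that[of z] g h gen generate_in_carrier[OF S]
    unfolding commuting_rel_def group_center_def by auto
qed

lemma card_image_eq_if_same_kernel:
  assumes "\<And>x y. x \<in> A \<Longrightarrow> y \<in> A \<Longrightarrow> f x = f y \<longleftrightarrow> g x = g y"
  shows "card (f ` A) = card (g ` A)"
proof (rule bij_betw_same_card)
  show "bij_betw (\<lambda>b. g (SOME x. x \<in> A \<and> f x = b)) (f ` A) (g ` A)"
  proof -
    have *: "g (SOME x. x \<in> A \<and> f x = f a) = g a" if "a \<in> A" for a
    proof -
      have "(SOME x. x \<in> A \<and> f x = f a) \<in> A \<and> f (SOME x. x \<in> A \<and> f x = f a) = f a"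
        by (rule someI[of _ a]) (use that in simp)
      then show ?thesis using assms that by blast
    qed
    show ?thesis
      unfolding bij_betw_def inj_on_def using assms by (auto simp: * image_image)
  qed
qed

text \<open>
  A function \<open>F\<close> that is a complete invariant of the components of the commuting graph on the
  nonidentity elements is one for the nilpotent graph as well. The two graphs have the same
  vertices because \<open>F\<close> takes more than one value: an element \<open>g \<noteq> \<one>\<close> of \<open>nil G\<close> would be joined to
  every other element by a commuting chain, which would make \<open>F\<close> constant.
\<close>
lemma (in group) kappa_eq_card_invariant:
  assumes fin: "finite (carrier G)"
    and inv: "\<And>g h. (g, h) \<in> commuting_rel G \<Longrightarrow> F g = F h"
    and conn: "\<And>g h. g \<in> carrier G - {\<one>} \<Longrightarrow> h \<in> carrier G - {\<one>} \<Longrightarrow> F g = F h \<Longrightarrow>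
      (g, h) \<in> (commuting_rel G)\<^sup>*"
    and two: "1 < card (F ` (carrier G - {\<one>}))"
  shows "kappa G = card (F ` (carrier G - {\<one>}))"
proof -
  have F_nilp: "F g = F h"
    if "g \<in> carrier G - {\<one>}" "h \<in> carrier G - {\<one>}"
      "nilpotent_group (generated_subgroup G {g, h})" for g h
    using nilpotent_pair_imp_commuting_chain[OF that] inv by metis
  have comm_nilp: "nilpotent_group (generated_subgroup G {g, h})"
    if "g \<in> carrier G" "h \<in> carrier G" "g \<otimes> h = h \<otimes> g" for g h
    using comm_group_imp_nilpotent_group[OF comm_group_generated_by_commuting_pair] that by blast
  have nil: "nil G = {\<one>}"
  proof (intro equalityI subsetI)
    fix g assume g: "g \<in> nil G"
    show "g \<in> {\<one>}"
    proof (rule ccontr)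
      assume "g \<notin> {\<one>}"
      then have "F h = F g" if "h \<in> carrier G - {\<one>}" for h
        using F_nilp[of g h] g that by (auto simp: nil_def)
      then have "F ` (carrier G - {\<one>}) \<subseteq> {F g}" by blast
      then have "card (F ` (carrier G - {\<one>})) \<le> 1"
        using card_mono[of "{F g}"] by simp
      with two show False by simp
    qed
  qed (use comm_nilp in \<open>auto simp: nil_def\<close>)
  interpret pair_graph "nilpotent_graph G" by (rule pair_graph_nilpotent_graph[OF fin])
  let ?V = "carrier G - {\<one>}" and ?N = "with_proj (nilpotent_graph G)"
  have verts: "pverts (nilpotent_graph G) = ?V" by (simp add: nilpotent_graph_def nil)
  have adj: "u \<rightarrow>\<^bsub>?N\<^esub> v \<longleftrightarrow> u \<in> ?V \<and> v \<in> ?V \<and> u \<noteq> v \<and>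
      nilpotent_group (generated_subgroup G {u, v})" for u v
    by (auto simp: nilpotent_graph_def nil arcs_ends_conv)
  have reach_F: "F u = F v" if "u \<rightarrow>\<^sup>*\<^bsub>?N\<^esub> v" for u v
    using that
  proof (induction rule: reachable_induct)
    case (step y z)
    then show ?case using F_nilp[of y z] adj[of y z] by simp
  qed simp
  have F_reach: "u \<rightarrow>\<^sup>*\<^bsub>?N\<^esub> v" if "u \<in> ?V" "v \<in> ?V" "F u = F v" for u v
    using conn[OF that]
  proof (induction rule: rtrancl_induct)
    case base
    then show ?case using that(1) verts by simp
  next
    case (step y z)
    then have "y \<in> ?V" "z \<in> ?V" "nilpotent_group (generated_subgroup G {y, z})"
      using comm_nilp by (auto simp: commuting_rel_def)
    then show ?case
      using step.IH adj[of y z] reachable_adj_trans[of u y z] by (cases "y = z") auto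
  qed
  have scc: "scc_of u = scc_of v \<longleftrightarrow> F u = F v" if "u \<in> ?V" "v \<in> ?V" for u v
  proof
    assume "scc_of u = scc_of v"
    moreover have "u \<in> scc_of u" using in_scc_of_self that verts by simp
    ultimately have "v \<rightarrow>\<^sup>*\<^bsub>?N\<^esub> u" by (simp add: scc_of_def)
    then show "F u = F v" using reach_F by metis
  next
    assume "F u = F v"
    then have "u \<rightarrow>\<^sup>*\<^bsub>?N\<^esub> v" "v \<rightarrow>\<^sup>*\<^bsub>?N\<^esub> u" using F_reach that by metis+
    then show "scc_of u = scc_of v"
      by (auto simp: scc_of_def intro: reachable_trans)
  qed
  have "kappa G = card (scc_of ` ?V)"
    by (simp add: kappa_def card_sccs_verts[symmetric] sccs_verts_conv_scc_of verts)
  also have "\<dots> = card (F ` ?V)" by (rule card_image_eq_if_same_kernel[OF scc])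
  finally show ?thesis .
qed

section \<open>Commuting elements of PSL(2, q)\<close>

definition mat2 :: "'a \<Rightarrow> 'a \<Rightarrow> 'a \<Rightarrow> 'a \<Rightarrow> 'a ^ 2 ^ 2" where
  "mat2 a b c d =
     (\<chi> i j. if i = 1 then if j = 1 then a else b else if j = 1 then c else d)"

lemma mat2_exhaust:
  obtains a b c d where "A = mat2 a b c d"
proof
  show "A = mat2 (A $ 1 $ 1) (A $ 1 $ 2) (A $ 2 $ 1) (A $ 2 $ 2)"
    by (simp add: mat2_def vec_eq_iff forall_2)
qed

lemma mat2_eq_iff [simp]:
  "mat2 a b c d = mat2 a' b' c' d' \<longleftrightarrow> a = a' \<and> b = b' \<and> c = c' \<and> d = d'"
  by (auto simp: mat2_def vec_eq_iff forall_2)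

lemma mat2_mult [simp]:
  "mat2 a b c d ** mat2 a' b' c' d' =
     mat2 (a * a' + b * c') (a * b' + b * d') (c * a' + d * c') (c * b' + d * d')"
  by (simp add: mat2_def vec_eq_iff forall_2 matrix_matrix_mult_def sum_2)

lemma det_mat2 [simp]: "det (mat2 a b c d) = a * d - b * c"
  by (simp add: mat2_def det_2)

lemma uminus_mat2 [simp]: "- mat2 a b c d = mat2 (- a) (- b) (- c) (- d)"
  by (simp add: mat2_def vec_eq_iff forall_2)

lemma mat_1_mat2: "mat 1 = mat2 1 0 0 1"
  by (simp add: mat2_def vec_eq_iff forall_2 mat_def)

lemma det_uminus2 [simp]: "det (- A) = det (A :: 'a::field ^ 2 ^ 2)"
  by (cases A rule: mat2_exhaust) simp

lemma matrix_mult_uminus2 [simp]: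
  fixes A B :: "'a::field ^ 2 ^ 2"
  shows "- A ** B = - (A ** B)" and "A ** - B = - (A ** B)"
  by (cases A rule: mat2_exhaust; cases B rule: mat2_exhaust; simp)+

text \<open>
  Commuting with the two elementary matrices already forces a matrix to be scalar, and the
  determinant leaves only the scalars \<open>\<plusminus>1\<close>.
\<close>
lemma group_center_SL2:
  "group_center SL = {mat 1, - mat 1 :: 'a::field ^ 2 ^ 2}"
proof (intro equalityI subsetI)
  fix A :: "'a ^ 2 ^ 2"
  assume A: "A \<in> group_center SL"
  obtain a b c d where abcd: "A = mat2 a b c d" by (rule mat2_exhaust)
  have "A ** B = B ** A" if "det B = 1" for B
    using A that by (auto simp: group_center_def SL_def)
  from this[of "mat2 1 1 0 1"] this[of "mat2 1 0 1 1"]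
  have "b = 0" "c = 0" "d = a" by (simp_all add: abcd)
  moreover have "det A = 1" using A by (auto simp: group_center_def SL_def)
  ultimately have "a = 1 \<or> a = - 1" "A = mat2 a 0 0 a"
    using square_eq_1_iff[of a] by (simp_all add: abcd)
  then show "A \<in> {mat 1, - mat 1}" by (auto simp: mat_1_mat2)
next
  fix A :: "'a ^ 2 ^ 2"
  assume "A \<in> {mat 1, - mat 1}"
  then show "A \<in> group_center SL" by (auto simp: group_center_def SL_def)
qed

text \<open>
  The coset of \<open>A\<close> modulo the center: the elements of \<open>PSL(2, q)\<close> are exactly these sets.
\<close>
definition pm :: "'a::field ^ 2 ^ 2 \<Rightarrow> ('a ^ 2 ^ 2) set" where
  "pm A = {A, - A}"

lemma pm_eq_iff: "pm A = pm B \<longleftrightarrow> A = B \<or> A = - B"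
  unfolding pm_def by (auto simp: doubleton_eq_iff)

lemma carrier_PSL2: "carrier PSL = pm ` {A :: 'a::field ^ 2 ^ 2. det A = 1}"
proof -
  have "{mat 1, - mat 1} #>\<^bsub>SL\<^esub> A = pm A" for A :: "'a ^ 2 ^ 2"
    by (auto simp: r_coset_def SL_def pm_def)
  then show ?thesis
    by (auto simp: PSL_def FactGroup_def RCOSETS_def group_center_SL2) (auto simp: SL_def)
qed

lemma one_PSL2: "\<one>\<^bsub>PSL\<^esub> = pm (mat 1 :: 'a::field ^ 2 ^ 2)"
  by (simp add: PSL_def FactGroup_def group_center_SL2 pm_def)

lemma mult_PSL2: "pm A \<otimes>\<^bsub>PSL\<^esub> pm B = pm (A ** B)"
  by (auto simp: PSL_def FactGroup_def set_mult_def SL_def pm_def)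

definition nonscalar_SL2 :: "('a::field ^ 2 ^ 2) set" where
  "nonscalar_SL2 = {A. det A = 1 \<and> A \<noteq> mat 1 \<and> A \<noteq> - mat 1}"

text \<open>
  Two matrices are related when their classes in \<open>PSL(2, q)\<close> commute, so anticommuting matrices
  are included.
\<close>
definition sign_commuting :: "('a::field ^ 2 ^ 2) rel" where
  "sign_commuting = {(A, B). A \<in> nonscalar_SL2 \<and> B \<in> nonscalar_SL2 \<and>
     (A ** B = B ** A \<or> A ** B = - (B ** A))}"

lemma nonidentity_PSL2: "carrier PSL - {\<one>\<^bsub>PSL\<^esub>} = pm ` nonscalar_SL2"
proof -
  have "{A :: 'a ^ 2 ^ 2. det A = 1} = insert (mat 1) (insert (- mat 1) nonscalar_SL2)"
    unfolding nonscalar_SL2_def by (auto simp: mat_1_mat2)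
  moreover have "pm (- mat 1) = pm (mat 1 :: 'a ^ 2 ^ 2)" by (simp add: pm_eq_iff)
  moreover have "pm (mat 1) \<notin> pm ` (nonscalar_SL2 :: ('a ^ 2 ^ 2) set)"
  proof
    assume "pm (mat 1) \<in> pm ` (nonscalar_SL2 :: ('a ^ 2 ^ 2) set)"
    then obtain A :: "'a ^ 2 ^ 2" where "A \<in> nonscalar_SL2" "pm A = pm (mat 1)" by auto
    then show False by (simp add: nonscalar_SL2_def pm_eq_iff)
  qed
  ultimately show ?thesis unfolding carrier_PSL2 one_PSL2 by simp
qed

lemma commuting_rel_PSL2:
  assumes "A \<in> nonscalar_SL2" and "B \<in> nonscalar_SL2"
  shows "(pm A, pm B) \<in> commuting_rel PSL \<longleftrightarrow> (A, B) \<in> sign_commuting"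
  using assms imageI[OF assms(1), of pm] imageI[OF assms(2), of pm]
  by (simp add: commuting_rel_def nonidentity_PSL2 mult_PSL2 pm_eq_iff sign_commuting_def)

lemma kappa_PSL2_eq_card_invariant:
  fixes f :: "'a::{field, finite} ^ 2 ^ 2 \<Rightarrow> 'b set"
  assumes sign: "\<And>A. f (- A) = f A"
    and inv: "\<And>A B. (A, B) \<in> sign_commuting \<Longrightarrow> f A = f B"
    and conn: "\<And>A B. A \<in> nonscalar_SL2 \<Longrightarrow> B \<in> nonscalar_SL2 \<Longrightarrow> f A = f B \<Longrightarrow>
      (A, B) \<in> sign_commuting\<^sup>*"
    and two: "1 < card (f ` nonscalar_SL2)"
  shows "kappa (PSL :: ('a ^ 2 ^ 2) set monoid) = card (f ` nonscalar_SL2)"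
proof -
  let ?G = "PSL :: ('a ^ 2 ^ 2) set monoid"
  interpret group ?G by (rule group_PSL)
  define F where "F X = \<Union> (f ` X)" for X
  have F_pm: "F (pm A) = f A" for A by (simp add: F_def pm_def sign)
  have image: "F ` (carrier ?G - {\<one>\<^bsub>?G\<^esub>}) = f ` nonscalar_SL2"
    by (simp only: nonidentity_PSL2 image_image F_pm)
  have lift: "(pm A, pm B) \<in> (commuting_rel ?G)\<^sup>*" if "(A, B) \<in> sign_commuting\<^sup>*" for A B
    using that
  proof (induction rule: rtrancl_induct)
    case (step B C)
    then have "(pm B, pm C) \<in> commuting_rel ?G"
      using commuting_rel_PSL2[of B C] by (auto simp: sign_commuting_def)
    with step.IH show ?case by simp
  qed simp
  have "kappa ?G = card (F ` (carrier ?G - {\<one>\<^bsub>?G\<^esub>}))"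
  proof (rule kappa_eq_card_invariant)
    show "finite (carrier ?G)" by simp
    show "F g = F h" if "(g, h) \<in> commuting_rel ?G" for g h
    proof -
      have "g \<in> pm ` nonscalar_SL2" "h \<in> pm ` nonscalar_SL2"
        using that by (simp_all add: commuting_rel_def flip: nonidentity_PSL2)
      then show ?thesis using that commuting_rel_PSL2 inv F_pm by blast
    qed
    show "(g, h) \<in> (commuting_rel ?G)\<^sup>*"
      if "g \<in> carrier ?G - {\<one>\<^bsub>?G\<^esub>}" "h \<in> carrier ?G - {\<one>\<^bsub>?G\<^esub>}" "F g = F h" for g h
      using that lift conn unfolding nonidentity_PSL2 by (auto simp: F_pm)
    show "1 < card (F ` (carrier ?G - {\<one>\<^bsub>?G\<^esub>}))" using two by (simp add: image)
  qed
  then show ?thesis by (simp add: image)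
qed

section \<open>Centralizers as points of the projective plane\<close>

text \<open>
  The point of the projective plane with homogeneous coordinates \<open>v\<close>, as the set of all
  nonzero multiples of \<open>v\<close>. The zero vector is admitted as an argument; it gives \<open>{(0, 0, 0)}\<close>,
  which is not among the \<open>plane_points\<close> below.
\<close>
definition point :: "'a::field \<times> 'a \<times> 'a \<Rightarrow> ('a \<times> 'a \<times> 'a) set" where
  "point v = (case v of (x, y, z) \<Rightarrow> {(t * x, t * y, t * z) | t. t \<noteq> 0})"

text \<open>
  The coordinates of \<open>A\<close> in the three-dimensional quotient of the matrix algebra by the scalar
  matrices.
\<close>
definition dir :: "'a::field ^ 2 ^ 2 \<Rightarrow> 'a \<times> 'a \<times> 'a" where
  "dir A = (A $ 1 $ 1 - A $ 2 $ 2, A $ 1 $ 2, A $ 2 $ 1)"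

lemma dir_mat2 [simp]: "dir (mat2 a b c d) = (a - d, b, c)"
  by (simp add: dir_def mat2_def)

lemma mem_point_iff:
  "w \<in> point (x, y, z) \<longleftrightarrow> (\<exists>t. t \<noteq> 0 \<and> w = (t * x, t * y, t * z))"
  by (auto simp: point_def)

lemma mem_point: "v \<in> point v"
proof (cases v)
  case (fields x y z)
  have "\<exists>t. t \<noteq> 0 \<and> (x, y, z) = (t * x, t * y, t * z)" by (rule exI[of _ 1]) simp
  then show ?thesis unfolding fields mem_point_iff .
qed

lemma point_scale: "t \<noteq> 0 \<Longrightarrow> point (t * x, t * y, t * z) = point (x, y, z)"
proof (intro equalityI subsetI)
  fix u assume "t \<noteq> 0" "u \<in> point (x, y, z)"
  then obtain s where "s \<noteq> 0" "u = (s * x, s * y, s * z)" by (auto simp: mem_point_iff)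
  then show "u \<in> point (t * x, t * y, t * z)"
    using \<open>t \<noteq> 0\<close> unfolding mem_point_iff by (intro exI[of _ "s / t"]) simp
next
  fix u assume "t \<noteq> 0" "u \<in> point (t * x, t * y, t * z)"
  then obtain s where "s \<noteq> 0" "u = (s * (t * x), s * (t * y), s * (t * z))"
    by (auto simp: mem_point_iff)
  then show "u \<in> point (x, y, z)"
    using \<open>t \<noteq> 0\<close> unfolding mem_point_iff by (intro exI[of _ "s * t"]) simp
qed

lemma point_eq_iff: "point v = point w \<longleftrightarrow> w \<in> point v"
proof
  assume "w \<in> point v"
  then show "point v = point w"
    by (cases v) (auto simp: mem_point_iff point_scale)
qed (use mem_point[of w] in simp)

lemma point_eq_iff_parallel:
  assumes "(x, y, z) \<noteq> (0, 0, 0)" and "(x', y', z') \<noteq> (0, 0, 0)"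
  shows "point (x, y, z) = point (x', y', z') \<longleftrightarrow>
    x * y' = x' * y \<and> x * z' = x' * z \<and> y * z' = y' * z"
proof
  assume "point (x, y, z) = point (x', y', z')"
  then show "x * y' = x' * y \<and> x * z' = x' * z \<and> y * z' = y' * z"
    unfolding point_eq_iff mem_point_iff by auto
next
  assume par: "x * y' = x' * y \<and> x * z' = x' * z \<and> y * z' = y' * z"
  have "\<exists>t. t \<noteq> 0 \<and> x' = t * x \<and> y' = t * y \<and> z' = t * z"
  proof -
    consider "x \<noteq> 0" | "y \<noteq> 0" | "z \<noteq> 0" using assms(1) by auto
    then show ?thesis
    proof cases
      case 1 then show ?thesis using par assms(2)
        by (intro exI[of _ "x' / x"]) (auto simp: field_simps)
    next
      case 2 then show ?thesis using par assms(2)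
        by (intro exI[of _ "y' / y"]) (auto simp: field_simps)
    next
      case 3 then show ?thesis using par assms(2)
        by (intro exI[of _ "z' / z"]) (auto simp: field_simps)
    qed
  qed
  then show "point (x, y, z) = point (x', y', z')"
    unfolding point_eq_iff mem_point_iff by auto
qed

lemma dir_nonscalar_nonzero:
  assumes "A \<in> nonscalar_SL2"
  shows "dir A \<noteq> (0, 0, 0)"
proof
  obtain a b c d where A: "A = mat2 a b c d" by (rule mat2_exhaust)
  assume "dir A = (0, 0, 0)"
  then have "d = a" "b = 0" "c = 0" by (simp_all add: A)
  then show False
    using assms square_eq_1_iff[of a] by (auto simp: A nonscalar_SL2_def mat_1_mat2)
qed

text \<open>
  The entries of \<open>A ** B - B ** A\<close> are, up to sign, the two-by-two minors of the vectors \<open>dir A\<close>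
  and \<open>dir B\<close>. In other words, the centralizer of a nonscalar \<open>A\<close> is the algebra generated by \<open>A\<close>,
  all of whose nonscalar elements have the same point.
\<close>
lemma commute_iff_same_point:
  assumes "A \<in> nonscalar_SL2" and "B \<in> nonscalar_SL2"
  shows "A ** B = B ** A \<longleftrightarrow> point (dir A) = point (dir B)"
proof -
  obtain a b c d where A: "A = mat2 a b c d" by (rule mat2_exhaust)
  obtain a' b' c' d' where B: "B = mat2 a' b' c' d'" by (rule mat2_exhaust)
  have "point (dir A) = point (dir B) \<longleftrightarrow>
      (a - d) * b' = (a' - d') * b \<and> (a - d) * c' = (a' - d') * c \<and> b * c' = b' * c"
    using dir_nonscalar_nonzero[OF assms(1)] dir_nonscalar_nonzero[OF assms(2)]
    unfolding A B dir_mat2 by (intro point_eq_iff_parallel)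
  also have "\<dots> \<longleftrightarrow> A ** B = B ** A"
  proof -
    have "a * a' + b * c' = a' * a + b' * c \<longleftrightarrow> b * c' = b' * c"
      by (simp add: mult.commute)
    moreover have "a * b' + b * d' = a' * b + b' * d \<longleftrightarrow> (a - d) * b' = (a' - d') * b"
      by (subst (1 2) eq_iff_diff_eq_0) (simp add: algebra_simps)
    moreover have "c * a' + d * c' = c' * a + d' * c \<longleftrightarrow> (a' - d') * c = (a - d) * c'"
      by (subst (1 2) eq_iff_diff_eq_0) (simp add: algebra_simps)
    moreover have "c * b' + d * d' = c' * b + d' * d \<longleftrightarrow> b' * c = b * c'"
      by (simp add: mult.commute)
    ultimately show ?thesis
      unfolding A B mat2_mult mat2_eq_iff by (metis (no_types))
  qed
  finally show ?thesis by simp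
qed

lemma point_uminus: "point (dir (- A)) = point (dir A)"
proof -
  obtain a b c d where A: "A = mat2 a b c d" by (rule mat2_exhaust)
  show ?thesis using point_scale[of "- 1" "a - d" b c] by (simp add: A)
qed

lemma card_eq_sum_card_fibres:
  assumes "finite A"
  shows "card A = (\<Sum>b \<in> f ` A. card {x \<in> A. f x = b})"
  using sum.image_gen[OF assms, of "\<lambda>_. 1 :: nat" f] by simp

lemma card_fibres:
  assumes "finite A" and "\<And>x. x \<in> A \<Longrightarrow> card {y \<in> A. f y = f x} = k"
  shows "card A = k * card (f ` A)"
proof -
  have "card A = (\<Sum>b \<in> f ` A. k)"
    unfolding card_eq_sum_card_fibres[OF assms(1), of f]
    by (rule sum.cong) (use assms(2) in auto)
  then show ?thesis by simp
qed

lemma card_image_le_half: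
  assumes "finite A" and "\<And>x. x \<in> A \<Longrightarrow> 2 \<le> card {y \<in> A. f y = f x}"
  shows "2 * card (f ` A) \<le> card A"
proof -
  have "(\<Sum>b \<in> f ` A. 2) \<le> (\<Sum>b \<in> f ` A. card {x \<in> A. f x = b})"
    by (rule sum_mono) (use assms(2) in auto)
  then show ?thesis by (simp add: card_eq_sum_card_fibres[OF assms(1), of f])
qed

definition plane_points :: "('a::field \<times> 'a \<times> 'a) set set" where
  "plane_points = point ` (UNIV - {(0, 0, 0)})"

lemma card_plane_points:
  "card (plane_points :: ('a::{field, finite} \<times> 'a \<times> 'a) set set) = CARD('a)^2 + CARD('a) + 1"
proof -
  define q where "q = CARD('a)"
  have q: "q > 1" unfolding q_def using card_mono[of UNIV "{0, 1 :: 'a}"] by simp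
  have "card (UNIV - {(0, 0, 0) :: 'a \<times> 'a \<times> 'a}) =
      (q - 1) * card (point ` (UNIV - {(0, 0, 0) :: 'a \<times> 'a \<times> 'a}))"
  proof (rule card_fibres)
    fix v :: "'a \<times> 'a \<times> 'a"
    assume v: "v \<in> UNIV - {(0, 0, 0)}"
    obtain x y z where xyz: "v = (x, y, z)" by (cases v)
    have iff: "point w = point v \<longleftrightarrow> w \<in> point v" for w
      by (metis point_eq_iff)
    have "(0, 0, 0) \<notin> point v" using v by (auto simp: mem_point_iff xyz)
    then have "{w \<in> UNIV - {(0, 0, 0)}. point w = point v} = point v" by (simp only: iff) blast
    also have "\<dots> = (\<lambda>t. (t * x, t * y, t * z)) ` (UNIV - {0})"
      unfolding xyz point_def by blast
    finally have "{w \<in> UNIV - {(0, 0, 0)}. point w = point v} =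
        (\<lambda>t. (t * x, t * y, t * z)) ` (UNIV - {0})" .
    moreover have "inj_on (\<lambda>t. (t * x, t * y, t * z)) (UNIV - {0})"
      using v by (auto simp: inj_on_def xyz)
    ultimately show "card {w \<in> UNIV - {(0, 0, 0)}. point w = point v} = q - 1"
      by (simp add: card_image card_Diff_singleton q_def)
  qed simp
  then have "q * (q * q) - 1 = (q - 1) * card (plane_points :: ('a \<times> 'a \<times> 'a) set set)"
    by (simp add: plane_points_def card_Diff_singleton q_def card_cartesian_product
        flip: UNIV_Times_UNIV)
  moreover have "q * (q * q) - 1 = (q - 1) * (q^2 + q + 1)"
  proof -
    obtain m where "q = Suc m" using q by (cases q) auto
    then show ?thesis by (simp add: algebra_simps power2_eq_square)
  qed
  ultimately have "(q - 1) * card (plane_points :: ('a \<times> 'a \<times> 'a) set set) =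
      (q - 1) * (q^2 + q + 1)"
    by (simp only:)
  then show ?thesis using q unfolding q_def[symmetric] mult_cancel1 by simp
qed

section \<open>Squares and roots in finite fields\<close>

text \<open>
  Multiplication by \<open>x\<close> permutes the nonzero elements, so it does not change their product.
\<close>
lemma finite_field_power_card_minus_1:
  fixes x :: "'a::{field, finite}"
  assumes "x \<noteq> 0"
  shows "x ^ (CARD('a) - 1) = 1"
proof -
  let ?U = "UNIV - {0 :: 'a}"
  have "(\<Prod>y \<in> ?U. y) = (\<Prod>y \<in> ?U. x * y)"
  proof (rule prod.reindex_bij_witness[where i = "\<lambda>y. x * y" and j = "\<lambda>y. y / x"])
  qed (use assms in auto)
  also have "\<dots> = x ^ (CARD('a) - 1) * (\<Prod>y \<in> ?U. y)"
    by (simp add: prod.distrib card_Diff_singleton)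
  finally show ?thesis by (simp add: prod_zero_iff)
qed

lemma exists_non_root:
  fixes p :: "'a::{field, finite} poly"
  assumes "p \<noteq> 0" and "degree p < CARD('a)"
  obtains x where "poly p x \<noteq> 0"
proof -
  have "card {x. poly p x = 0} < CARD('a)"
    using card_poly_roots_bound[OF assms(1)] assms(2) by linarith
  then have "{x. poly p x = 0} \<noteq> UNIV" by auto
  then show thesis using that by blast
qed

text \<open>
  The polynomial \<open>X ^ (m + 1) - X\<close> cannot vanish on the whole field; the extra factor \<open>X\<close> keeps the
  non-root away from zero.
\<close>
lemma exists_power_ne_1:
  assumes "0 < m" and "m < CARD('a::{field, finite}) - 1"
  obtains x :: "'a::{field, finite}" where "x \<noteq> 0" and "x ^ m \<noteq> 1"
proof -
  let ?p = "monom (1 :: 'a) (Suc m) - monom 1 1"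
  have "coeff ?p (Suc m) \<noteq> 0" using assms(1) by simp
  then have "?p \<noteq> 0" by (metis coeff_0)
  moreover have "degree ?p \<le> Suc m"
    by (rule degree_diff_le) (simp_all add: degree_monom_eq)
  then have "degree ?p < CARD('a)" using assms(2) by linarith
  ultimately obtain x where "poly ?p x \<noteq> 0" by (rule exists_non_root)
  then show thesis using that[of x] by (cases "x = 0") (auto simp: poly_monom)
qed

text \<open>
  Here \<open>q - 1\<close> is odd, so \<open>(- 1) ^ (q - 1) = 1\<close> says that \<open>- 1 = 1\<close>.
\<close>
lemma two_eq_0_if_card_even:
  assumes "even CARD('a::{field, finite})"
  shows "(2 :: 'a) = 0"
proof -
  have "odd (CARD('a) - 1)" using assms by simp
  then have "- 1 = (1 :: 'a)" using finite_field_power_card_minus_1[of "- 1 :: 'a"] by simp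
  then have "1 + 1 = (0 :: 'a)" by (simp add: minus_equation_iff eq_neg_iff_add_eq_0)
  then show ?thesis by simp
qed

text \<open>
  If \<open>- 1 = 1\<close>, then one has a single square root; so \<open>x ^ m = 1\<close> for all \<open>q - 1 = 2 m\<close> nonzero
  elements \<open>x\<close>, which are more than a polynomial of degree \<open>m\<close> can have as roots.
\<close>
lemma two_ne_0_if_card_odd:
  assumes "odd CARD('a::{field, finite})"
  shows "(2 :: 'a) \<noteq> 0"
proof
  assume two: "(2 :: 'a) = 0"
  obtain m where m: "CARD('a) = 2 * m + 1" using assms by (rule oddE)
  have "card {0, 1 :: 'a} \<le> CARD('a)" by (rule card_mono) simp_all
  then have "0 < m" "m < CARD('a) - 1" using m by simp_all
  then obtain x :: 'a where x: "x \<noteq> 0" "x ^ m \<noteq> 1"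
    by (rule exists_power_ne_1)
  have "(x ^ m) ^ 2 = 1"
    using finite_field_power_card_minus_1[OF x(1)] m by (simp add: mult.commute flip: power_mult)
  then have "x ^ m = - 1" using x(2) by (simp add: power2_eq_1_iff)
  moreover have "- 1 = (1 :: 'a)" using two by (simp add: minus_equation_iff eq_neg_iff_add_eq_0)
  ultimately show False using x(2) by simp
qed

text \<open>
  As \<open>c ^ q = c\<close>, the power \<open>c ^ (q div 2)\<close> is a root.
\<close>
lemma exists_sqrt_if_card_even:
  fixes c :: "'a::{field, finite}"
  assumes "even CARD('a)"
  obtains r where "r ^ 2 = c"
proof (cases "c = 0")
  case False
  have "(c ^ (CARD('a) div 2)) ^ 2 = c ^ CARD('a)"
    using assms by (simp flip: power_mult)
  also have "\<dots> = c * c ^ (CARD('a) - 1)"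
    by (subst power_Suc[symmetric]) (simp add: Suc_diff_Suc)
  also have "\<dots> = c" using finite_field_power_card_minus_1[OF False] by simp
  finally show ?thesis using that by blast
qed (use that[of 0] in simp)

text \<open>
  With \<open>q = 4 k + 1\<close>, some \<open>x ^ (2 k)\<close> differs from one, and its square is one. Therefore
  \<open>x ^ (2 k) = - 1\<close>, and \<open>x ^ k\<close> is a root.
\<close>
lemma exists_sqrt_minus_1:
  assumes "CARD('a::{field, finite}) mod 4 = 1"
  obtains j :: "'a::{field, finite}" where "j ^ 2 = - 1"
proof -
  define k where "k = CARD('a) div 4"
  have k: "CARD('a) = 4 * k + 1" unfolding k_def using assms by presburger
  have "card {0, 1 :: 'a} \<le> CARD('a)" by (rule card_mono) simp_all
  then have "0 < 2 * k" "2 * k < CARD('a) - 1" using k by simp_all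
  then obtain x :: 'a where x: "x \<noteq> 0" "x ^ (2 * k) \<noteq> 1"
    by (rule exists_power_ne_1)
  have "(x ^ (2 * k)) ^ 2 = x ^ (CARD('a) - 1)" by (simp add: k flip: power_mult)
  then have "(x ^ (2 * k)) ^ 2 = 1"
    using finite_field_power_card_minus_1[OF x(1)] by simp
  then have "x ^ (2 * k) = - 1" using x(2) by (simp add: power2_eq_1_iff)
  then have "(x ^ k) ^ 2 = - 1" by (simp add: mult.commute flip: power_mult)
  then show thesis by (rule that)
qed

text \<open>
  A square root of \<open>- 1\<close> would have \<open>(q - 1)\<close>-th power \<open>(- 1) ^ ((q - 1) / 2)\<close>,
  which is \<open>- 1\<close> because the exponent is odd.
\<close>
lemma minus_1_nonsquare:
  fixes j :: "'a::{field, finite}"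
  assumes "CARD('a) mod 4 = 3"
  shows "j ^ 2 \<noteq> - 1"
proof
  assume j: "j ^ 2 = - 1"
  define k where "k = CARD('a) div 4"
  have k: "CARD('a) = 4 * k + 3" unfolding k_def using assms by presburger
  have "j ^ (CARD('a) - 1) = (j ^ 2) ^ (2 * k + 1)"
    unfolding power_mult[symmetric] by (rule arg_cong) (simp add: k)
  also have "\<dots> = - 1" by (simp add: j)
  finally have "j ^ (CARD('a) - 1) = - 1" .
  moreover have "j \<noteq> 0" using j by auto
  ultimately have "- 1 = (1 :: 'a)" using finite_field_power_card_minus_1[of j] by metis
  then have "2 = (0 :: 'a)" by (metis add.right_inverse one_add_one)
  moreover have "odd CARD('a)" by (simp add: k)
  ultimately show False using two_ne_0_if_card_odd[where 'a='a] by simp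
qed

text \<open>
  With \<open>q = 4 k + 3\<close>, the power \<open>c ^ (2 k + 1)\<close> squares to one, so it is \<open>\<plusminus>1\<close>, and multiplying
  it by \<open>c\<close> gives the square of \<open>c ^ (k + 1)\<close>.
\<close>
lemma square_or_minus_square:
  fixes c :: "'a::{field, finite}"
  assumes "CARD('a) mod 4 = 3"
  obtains r where "r ^ 2 = c \<or> r ^ 2 = - c"
proof (cases "c = 0")
  case False
  define k where "k = CARD('a) div 4"
  have k: "CARD('a) = 4 * k + 3" unfolding k_def using assms by presburger
  have "(c ^ (2 * k + 1)) ^ 2 = c ^ (CARD('a) - 1)"
    unfolding power_mult[symmetric] by (rule arg_cong) (simp add: k)
  then have "c ^ (2 * k + 1) = 1 \<or> c ^ (2 * k + 1) = - 1"
    using finite_field_power_card_minus_1[OF False] by (simp add: power2_eq_1_iff)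
  moreover have "(c ^ (k + 1)) ^ 2 = c * c ^ (2 * k + 1)"
    unfolding power_mult[symmetric] power_Suc[symmetric] by (rule arg_cong) simp
  ultimately have "(c ^ (k + 1)) ^ 2 = c \<or> (c ^ (k + 1)) ^ 2 = - c" by auto
  then show ?thesis by (rule that)
qed (use that[of 0] in simp)

lemma sets_of_more_than_half_meet:
  assumes "finite (UNIV :: 'a set)" and "CARD('a) < 2 * card A" and "CARD('a) < 2 * card B"
  shows "A \<inter> B \<noteq> ({} :: 'a set)"
proof
  assume "A \<inter> B = {}"
  then have "card A + card B = card (A \<union> B)"
    using finite_subset[OF subset_UNIV assms(1)] by (simp add: card_Un_disjoint)
  also have "\<dots> \<le> CARD('a)" by (rule card_mono) (use assms(1) in auto)
  finally show False using assms by linarith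
qed

text \<open>
  If \<open>t\<^sup>2 + c\<^sup>2\<close> is a square \<open>r\<^sup>2\<close>, then \<open>(r - t) (r + t) = c\<^sup>2\<close> gives \<open>t = (c\<^sup>2 / m - m) / 2\<close> with
  \<open>m = r - t\<close>. Both \<open>m\<close> and \<open>- c\<^sup>2 / m\<close> produce the same \<open>t\<close>, so at most \<open>(q - 1) / 2\<close> values of \<open>t\<close>
  are of this kind; for all others \<open>- (t\<^sup>2 + c\<^sup>2)\<close> is a square. That these form a strict majority
  is what makes the involutions connected when \<open>q \<equiv> 3 (mod 4)\<close>.
\<close>
lemma card_minus_sum_squares:
  fixes c :: "'a::{field, finite}"
  assumes q: "CARD('a) mod 4 = 3" and c: "c \<noteq> 0"
  shows "CARD('a) < 2 * card {t. \<exists>r. r ^ 2 = - (t ^ 2 + c ^ 2)}" (is "_ < 2 * card ?D")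
proof -
  \<comment> \<open>the parametrization of the \<open>t\<close> for which \<open>t\<^sup>2 + c\<^sup>2\<close> is a square\<close>
  define g where "g = (\<lambda>m :: 'a. (c ^ 2 / m - m) / 2)"
  have two: "(2 :: 'a) \<noteq> 0"
    by (rule two_ne_0_if_card_odd) (use q in presburger)
  have no: "s ^ 2 + c ^ 2 \<noteq> 0" for s
  proof
    assume "s ^ 2 + c ^ 2 = 0"
    then have "(s / c) ^ 2 = - 1"
      using c by (simp add: power_divide field_simps eq_neg_iff_add_eq_0)
    then show False using minus_1_nonsquare[OF q] by blast
  qed
  have "- ?D \<subseteq> g ` (UNIV - {0})"
  proof
    fix t assume t: "t \<in> - ?D"
    obtain r where r: "r ^ 2 = t ^ 2 + c ^ 2"
      using square_or_minus_square[OF q, of "t ^ 2 + c ^ 2"] t by auto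
    have rt: "(r - t) * (r + t) = c ^ 2" using r by (simp add: algebra_simps power2_eq_square)
    then have "r - t \<noteq> 0" using c by auto
    moreover have "t = g (r - t)"
    proof -
      have "c ^ 2 / (r - t) = r + t" using rt \<open>r - t \<noteq> 0\<close> by (simp add: field_simps)
      then show ?thesis using two by (simp add: g_def)
    qed
    ultimately show "t \<in> g ` (UNIV - {0})" by blast
  qed
  then have "card (- ?D) \<le> card (g ` (UNIV - {0}))" by (intro card_mono) simp_all
  moreover have "2 * card (g ` (UNIV - {0})) \<le> card (UNIV - {0 :: 'a})"
  proof (rule card_image_le_half)
    fix m :: 'a assume m: "m \<in> UNIV - {0}"
    have "m \<noteq> - (c ^ 2 / m)"
      using no[of m] m by (auto simp: power2_eq_square field_simps eq_neg_iff_add_eq_0)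
    then have "2 = card {m, - (c ^ 2 / m)}" by simp
    also have "\<dots> \<le> card {m' \<in> UNIV - {0}. g m' = g m}"
      by (rule card_mono) (use m c in \<open>auto simp: g_def\<close>)
    finally show "2 \<le> card {m' \<in> UNIV - {0}. g m' = g m}" .
  qed simp
  moreover have "card ?D + card (- ?D) = CARD('a)"
    by (simp add: Compl_eq_Diff_UNIV card_Diff_subset card_mono)
  moreover have "card (UNIV - {0 :: 'a}) < CARD('a)" by (simp add: card_Diff_singleton)
  ultimately show ?thesis by linarith
qed

section \<open>Every point is the point of a matrix of determinant one\<close>

lemma nonscalar_SL2_iff: "A \<in> nonscalar_SL2 \<longleftrightarrow> det A = 1 \<and> dir A \<noteq> (0, 0, 0)"
proof -
  have "A \<in> nonscalar_SL2" if "det A = 1" "dir A \<noteq> (0, 0, 0)"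
    using that by (auto simp: nonscalar_SL2_def mat_1_mat2)
  then show ?thesis
    using dir_nonscalar_nonzero by (auto simp: nonscalar_SL2_def)
qed

lemma sign_commuting_sym: "(A, B) \<in> sign_commuting \<Longrightarrow> (B, A) \<in> sign_commuting"
  by (auto simp: sign_commuting_def)

lemma sign_commuting_rtrancl_sym:
  "(A, B) \<in> sign_commuting\<^sup>* \<Longrightarrow> (B, A) \<in> sign_commuting\<^sup>*"
  by (meson sign_commuting_sym symI sym_rtrancl symD)

lemma same_point_sign_commuting:
  assumes "A \<in> nonscalar_SL2" and "B \<in> nonscalar_SL2" and "point (dir A) = point (dir B)"
  shows "(A, B) \<in> sign_commuting"
  using assms commute_iff_same_point by (auto simp: sign_commuting_def)

lemma points_of_nonscalar_subset: "(\<lambda>A. point (dir A)) ` nonscalar_SL2 \<subseteq> plane_points"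
  using dir_nonscalar_nonzero by (auto simp: plane_points_def)

text \<open>
  A point is a plane through the scalars in the matrix algebra. Every such plane contains
  nonscalar matrices of nonzero determinant, as the determinant is there a quadratic polynomial
  and the field has more than two elements.
  For even \<open>q\<close> the determinant can be made one by scaling, since every element is a square.
\<close>
lemma points_of_nonscalar_SL2_even:
  assumes "even CARD('a::{field, finite})" and "CARD('a) \<noteq> 2"
  shows "(\<lambda>A. point (dir A)) ` (nonscalar_SL2 :: ('a ^ 2 ^ 2) set) = plane_points"
proof (intro equalityI points_of_nonscalar_subset subsetI)
  fix P :: "('a \<times> 'a \<times> 'a) set"
  assume "P \<in> plane_points"
  then obtain x y z where P: "P = point (x, y, z)" and nz: "(x, y, z) \<noteq> (0, 0, 0)"
    by (auto simp: plane_points_def)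
  have "card {0, 1 :: 'a} \<le> CARD('a)" by (rule card_mono) simp_all
  with assms(2) have "2 < CARD('a)" by simp
  then obtain m where "poly [:- (y * z), x, 1:] m \<noteq> 0"
    using exists_non_root[of "[:- (y * z), x, 1:]"] by auto
  then have N: "m * (m + x) - y * z \<noteq> 0" by (simp add: algebra_simps)
  obtain r where r: "r ^ 2 = inverse (m * (m + x) - y * z)"
    using exists_sqrt_if_card_even[OF assms(1)] by blast
  define A where "A = mat2 (r * (m + x)) (r * y) (r * z) (r * m)"
  have "det A = r ^ 2 * (m * (m + x) - y * z)"
    by (simp add: A_def algebra_simps power2_eq_square)
  then have "det A = 1" using r N by simp
  moreover have "r \<noteq> 0" using r N by auto
  moreover have "dir A = (r * x, r * y, r * z)" by (simp add: A_def algebra_simps)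
  ultimately have "A \<in> nonscalar_SL2" "point (dir A) = P"
    using nz by (auto simp: nonscalar_SL2_iff P point_scale)
  then show "P \<in> (\<lambda>A. point (dir A)) ` nonscalar_SL2" by blast
qed

text \<open>
  For odd \<open>q\<close>, the matrices of determinant one in the plane belonging to \<open>(x, y, z)\<close> form a conic
  through the identity. A line through the identity of slope \<open>m\<close> meets the conic in a second
  point unless \<open>m\<close> is a root of one of the two polynomials below; their product is cubic, which is
  why \<open>q > 3\<close> is needed.
\<close>
lemma points_of_nonscalar_SL2_odd:
  assumes two: "(2 :: 'a::{field, finite}) \<noteq> 0" and "3 < CARD('a)"
  shows "(\<lambda>A. point (dir A)) ` (nonscalar_SL2 :: ('a ^ 2 ^ 2) set) = plane_points"
proof (intro equalityI points_of_nonscalar_subset subsetI)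
  fix P :: "('a \<times> 'a \<times> 'a) set"
  assume "P \<in> plane_points"
  then obtain x y z where P: "P = point (x, y, z)" and nz: "(x, y, z) \<noteq> (0, 0, 0)"
    by (auto simp: plane_points_def)
  define p where "p = [:x, 2:] * [:- (y * z), x, 1:]"
  have "degree p = 3" unfolding p_def using two by (subst degree_mult_eq) auto
  moreover have "p \<noteq> 0" using two by (simp add: p_def)
  ultimately obtain m where "poly p m \<noteq> 0"
    using exists_non_root[of p] assms(2) by metis
  moreover have "poly p m = (2 * m + x) * (m ^ 2 + m * x - y * z)"
    by (simp add: p_def algebra_simps power2_eq_square)
  ultimately have M: "2 * m + x \<noteq> 0" and N: "m ^ 2 + m * x - y * z \<noteq> 0"
    by simp_all
  define s where "s = - (2 * m + x) / (m ^ 2 + m * x - y * z)"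
  define A where "A = mat2 (1 + m * s + s * x) (s * y) (s * z) (1 + m * s)"
  have "s * (m ^ 2 + m * x - y * z) = - (2 * m + x)" using N by (simp add: s_def)
  moreover have "det A = 1 + s * (2 * m + x + s * (m ^ 2 + m * x - y * z))"
    by (simp add: A_def algebra_simps power2_eq_square)
  ultimately have "det A = 1" by simp
  moreover have "s \<noteq> 0" unfolding s_def using M N by (metis divide_eq_0_iff neg_equal_0_iff_equal)
  moreover have "dir A = (s * x, s * y, s * z)" by (simp add: A_def)
  ultimately have "A \<in> nonscalar_SL2" "point (dir A) = P"
    using nz by (auto simp: nonscalar_SL2_iff P point_scale)
  then show "P \<in> (\<lambda>A. point (dir A)) ` nonscalar_SL2" by blast
qed

section \<open>Connectedness of the involutions\<close>

text \<open>
  By the theorem of Cayley and Hamilton, these matrices satisfy \<open>A\<^sup>2 = - 1\<close>; for odd \<open>q\<close> they are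
  precisely the ones that represent the involutions of \<open>PSL(2, q)\<close>.
\<close>
definition involutions_SL2 :: "('a::field ^ 2 ^ 2) set" where
  "involutions_SL2 = {A. det A = 1 \<and> A $ 1 $ 1 + A $ 2 $ 2 = 0}"

lemma mat2_involution_iff:
  "mat2 a b c d \<in> involutions_SL2 \<longleftrightarrow> d = - a \<and> a ^ 2 + b * c = - 1"
proof -
  have "det (mat2 a b c (- a)) = 1 \<longleftrightarrow> a ^ 2 + b * c = - 1"
    unfolding det_mat2 using minus_equation_iff[of "a ^ 2 + b * c" 1]
    by (auto simp: power2_eq_square)
  moreover have "a + d = 0 \<longleftrightarrow> d = - a" by (metis add.commute add_eq_0_iff)
  ultimately show ?thesis
    unfolding involutions_SL2_def mem_Collect_eq by (auto simp: mat2_def)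
qed

lemma involution_mat2:
  assumes "A \<in> involutions_SL2"
  obtains a b c where "A = mat2 a b c (- a)" and "a ^ 2 + b * c = - 1"
proof -
  obtain a b c d where "A = mat2 a b c d" by (rule mat2_exhaust)
  then show thesis using that assms by (auto simp: mat2_involution_iff)
qed

lemma involutions_SL2_nonscalar:
  assumes "(2 :: 'a::field) \<noteq> 0" and "A \<in> involutions_SL2"
  shows "(A :: 'a ^ 2 ^ 2) \<in> nonscalar_SL2"
  using assms by (auto simp: involutions_SL2_def nonscalar_SL2_def mat_def)

text \<open>
  The relation \<open>A = - B A B\<inverse>\<close> shows that the trace of \<open>A\<close> is its own negative.
\<close>
lemma anticommuting_imp_involution:
  assumes two: "(2 :: 'a::field) \<noteq> 0" and "det A = 1" and "det B = 1"
    and AB: "A ** B = - (B ** A)"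
  shows "(A :: 'a ^ 2 ^ 2) \<in> involutions_SL2"
proof -
  obtain a b c d where A: "A = mat2 a b c d" by (rule mat2_exhaust)
  obtain a' b' c' d' where B: "B = mat2 a' b' c' d'" by (rule mat2_exhaust)
  have "a' * d' - b' * c' = 1" using assms(3) by (simp add: B)
  moreover have "a * a' + b * c' = - (a' * a + b' * c)" "a * b' + b * d' = - (a' * b + b' * d)"
    "c * a' + d * c' = - (c' * a + d' * c)" "c * b' + d * d' = - (c' * b + d' * d)"
    using AB by (simp_all add: A B)
  \<comment> \<open>the trace of \<open>adj B (A B + B A) = 0\<close>, which is twice the trace of \<open>A\<close> as \<open>det B = 1\<close>\<close>
  ultimately have "2 * (a + d) = 0" by algebra
  then have "a + d = 0" using two by (metis mult_eq_0_iff)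
  then show ?thesis using assms(2) by (simp add: A involutions_SL2_def mat2_def)
qed

text \<open>
  For traceless matrices, \<open>A B + B A\<close> is the scalar \<open>tr (A B)\<close>; the hypothesis says that this
  trace vanishes.
\<close>
lemma orthogonal_involutions_anticommute:
  fixes a :: "'a::field"
  assumes "2 * a * a' + b * c' + b' * c = 0"
  shows "mat2 a b c (- a) ** mat2 a' b' c' (- a') = - (mat2 a' b' c' (- a') ** mat2 a b c (- a))"
proof -
  have "a * a' + b * c' = - (a' * a + b' * c)" using assms by algebra
  moreover have "c * b' + - a * - a' = - (c' * b + - a' * - a)" using assms by algebra
  ultimately show ?thesis unfolding mat2_mult uminus_mat2 mat2_eq_iff by (simp add: algebra_simps)
qed

text \<open>
  Half-plane coordinates of an involution: viewed as a fractional linear map, \<open>half_plane x y\<close>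
  has the fixed points \<open>x \<plusminus> i y\<close>, where \<open>i\<^sup>2 = - 1\<close>. Only the involutions that fix infinity are left
  out; these are the upper triangular ones, and they exist only if \<open>- 1\<close> is a square.
\<close>
definition half_plane :: "'a::field \<Rightarrow> 'a \<Rightarrow> 'a ^ 2 ^ 2" where
  "half_plane x y = mat2 (x / y) (- (x ^ 2 + y ^ 2) / y) (1 / y) (- (x / y))"

lemma half_plane_involution: "y \<noteq> 0 \<Longrightarrow> half_plane x y \<in> involutions_SL2"
  by (simp add: half_plane_def mat2_involution_iff field_simps power2_eq_square)

lemma involution_half_plane:
  assumes "mat2 a b c (- a) \<in> involutions_SL2" and "c \<noteq> 0"
  shows "mat2 a b c (- a) = half_plane (a / c) (1 / c)"
proof -
  have "a ^ 2 + b * c = - 1" using assms(1) by (simp add: mat2_involution_iff)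
  then have "b = - (a ^ 2 + 1) / c" using assms(2) by (simp add: field_simps)
  then show ?thesis using assms(2)
    by (simp add: half_plane_def power_divide) (simp add: field_simps power2_eq_square)
qed

lemma half_plane_step:
  assumes two: "(2 :: 'a::field) \<noteq> 0" and "y \<noteq> 0" and "y' \<noteq> 0"
    and "(x - x') ^ 2 + y ^ 2 + y' ^ 2 = 0"
  shows "(half_plane x y, half_plane x' y') \<in> (sign_commuting :: ('a ^ 2 ^ 2) rel)"
proof -
  have "2 * (x / y) * (x' / y') + (- (x ^ 2 + y ^ 2) / y) * (1 / y') +
      (- (x' ^ 2 + y' ^ 2) / y') * (1 / y)
      = - ((x - x') ^ 2 + y ^ 2 + y' ^ 2) / (y * y')"
    using assms(2,3) by (simp add: field_simps power2_eq_square)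
  also have "\<dots> = 0" by (simp add: assms(4))
  finally have "half_plane x y ** half_plane x' y' = - (half_plane x' y' ** half_plane x y)"
    unfolding half_plane_def by (rule orthogonal_involutions_anticommute)
  then show ?thesis
    using assms(2,3)
    by (simp add: sign_commuting_def involutions_SL2_nonscalar[OF two] half_plane_involution)
qed

text \<open>
  Two points of the same height \<open>c\<close> at distance \<open>2 t\<close> have a common neighbour above their midpoint,
  provided that \<open>- (t\<^sup>2 + c\<^sup>2)\<close> is a nonzero square. This holds for more than half of all \<open>t\<close>, so the
  points that can be reached from two given points of height \<open>c\<close> overlap, and all points of the
  same height are connected. Moreover, there is a point of height \<open>v\<close> adjacent to one of height
  \<open>y\<close> if \<open>- (v\<^sup>2 + y\<^sup>2)\<close> is a square; by majority again, some \<open>v\<close> serves both \<open>y\<close> and \<open>y'\<close>.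
\<close>
lemma half_plane_connected_3_mod_4:
  fixes x x' y y' :: "'a::{field, finite}"
  assumes q: "CARD('a) mod 4 = 3" and y: "y \<noteq> 0" "y' \<noteq> 0"
  shows "(half_plane x y, half_plane x' y') \<in> sign_commuting\<^sup>*"
proof -
  have two: "(2 :: 'a) \<noteq> 0"
    by (rule two_ne_0_if_card_odd) (use q in presburger)
  define D where "D c = {t :: 'a. \<exists>r. r ^ 2 = - (t ^ 2 + c ^ 2)}" for c
  have D_root: "\<exists>r. r \<noteq> 0 \<and> t ^ 2 + c ^ 2 + r ^ 2 = 0" if "t \<in> D c" "c \<noteq> 0" for t c
  proof -
    obtain r where r: "r ^ 2 = - (t ^ 2 + c ^ 2)" using \<open>t \<in> D c\<close> by (auto simp: D_def)
    have "r \<noteq> 0"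
    proof
      assume "r = 0"
      then have "(t / c) ^ 2 = - 1"
        using r that(2) by (simp add: power_divide field_simps eq_neg_iff_add_eq_0)
      then show False using minus_1_nonsquare[OF q] by blast
    qed
    then show ?thesis using r by (intro exI[of _ r]) simp
  qed
  have meet: "\<exists>t. t \<in> D c \<and> t + s \<in> D c'" if "c \<noteq> 0" "c' \<noteq> 0" for c c' s
  proof -
    have "card ((\<lambda>t. t - s) ` D c') = card (D c')" by (rule card_image) (simp add: inj_on_def)
    then have "D c \<inter> (\<lambda>t. t - s) ` D c' \<noteq> {}"
      using card_minus_sum_squares[OF q] that unfolding D_def[symmetric]
      by (intro sets_of_more_than_half_meet) simp_all
    then show ?thesis by auto
  qed
  have to: "(half_plane u c, half_plane (u - 2 * t) c) \<in> sign_commuting\<^sup>*"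
    if "t \<in> D c" "c \<noteq> 0" for t u c
  proof -
    obtain r where r: "r \<noteq> 0" "t ^ 2 + c ^ 2 + r ^ 2 = 0"
      using D_root \<open>t \<in> D c\<close> \<open>c \<noteq> 0\<close> by blast
    have "(half_plane u c, half_plane (u - t) r) \<in> sign_commuting"
      by (rule half_plane_step[OF two that(2) r(1)]) (use r(2) in simp)
    moreover have "(half_plane (u - t) r, half_plane (u - 2 * t) c) \<in> sign_commuting"
      by (rule half_plane_step[OF two r(1) that(2)]) (use r(2) in \<open>simp add: ac_simps\<close>)
    ultimately show ?thesis by (meson converse_rtrancl_into_rtrancl r_into_rtrancl)
  qed
  have horizontal: "(half_plane u c, half_plane u' c) \<in> sign_commuting\<^sup>*" if "c \<noteq> 0" for u u' c :: 'a
  proof -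
    obtain t where t: "t \<in> D c" "t + (u' - u) / 2 \<in> D c"
      using meet \<open>c \<noteq> 0\<close> by blast
    \<comment> \<open>both points reach the same third point of height \<open>c\<close>\<close>
    have "u' - 2 * (t + (u' - u) / 2) = u - 2 * t" using two by (simp add: field_simps)
    then show ?thesis
      using to[OF t(1) that, of u] to[OF t(2) that, of u'] sign_commuting_rtrancl_sym
      by (metis rtrancl_trans)
  qed
  have vertical: "\<exists>u. (half_plane 0 c, half_plane u v) \<in> sign_commuting"
    if "v \<in> D c" "c \<noteq> 0" "v \<noteq> 0" for c v
  proof -
    obtain r where "v ^ 2 + c ^ 2 + r ^ 2 = 0"
      using D_root \<open>v \<in> D c\<close> \<open>c \<noteq> 0\<close> by blast
    then show ?thesis
      using half_plane_step[OF two that(2,3), of 0 r] by (auto simp: algebra_simps)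
  qed
  obtain v where v: "v \<in> D y" "v \<in> D y'" using meet[of y y' 0] y by auto
  have "v \<noteq> 0"
  proof
    assume "v = 0"
    then obtain r where "r ^ 2 = - (y ^ 2)" using v(1) by (auto simp: D_def)
    then have "(r / y) ^ 2 = - 1" using y by (simp add: power_divide)
    then show False using minus_1_nonsquare[OF q] by blast
  qed
  obtain u u' where u: "(half_plane 0 y, half_plane u v) \<in> sign_commuting"
      "(half_plane 0 y', half_plane u' v) \<in> sign_commuting"
    using vertical v y \<open>v \<noteq> 0\<close> by metis
  have "(half_plane x y, half_plane 0 y) \<in> sign_commuting\<^sup>*" by (rule horizontal[OF y(1)])
  also note r_into_rtrancl[OF u(1)]
  also have "(half_plane u v, half_plane u' v) \<in> sign_commuting\<^sup>*"
    by (rule horizontal[OF \<open>v \<noteq> 0\<close>])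
  also note r_into_rtrancl[OF sign_commuting_sym[OF u(2)]]
  also have "(half_plane 0 y', half_plane x' y') \<in> sign_commuting\<^sup>*" by (rule horizontal[OF y(2)])
  finally show ?thesis .
qed

lemma involutions_connected_3_mod_4:
  assumes "CARD('a::{field, finite}) mod 4 = 3"
    and "A \<in> involutions_SL2" and "B \<in> involutions_SL2"
  shows "(A, B :: 'a ^ 2 ^ 2) \<in> sign_commuting\<^sup>*"
proof -
  have "\<exists>x y. y \<noteq> 0 \<and> C = half_plane x y" if "C \<in> involutions_SL2" for C :: "'a ^ 2 ^ 2"
  proof -
    obtain a b c where C: "C = mat2 a b c (- a)" "a ^ 2 + b * c = - 1"
      by (rule involution_mat2[OF \<open>C \<in> involutions_SL2\<close>])
    then have "c \<noteq> 0" using minus_1_nonsquare[OF assms(1)] by auto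
    then have "C = half_plane (a / c) (1 / c)"
      using involution_half_plane that C(1) by blast
    moreover have "1 / c \<noteq> 0" using \<open>c \<noteq> 0\<close> by simp
    ultimately show ?thesis by blast
  qed
  then show ?thesis using half_plane_connected_3_mod_4[OF assms(1)] assms(2,3) by metis
qed

text \<open>
  The involution whose fixed points are infinity and \<open>x\<close> commutes with all involutions
  \<open>half_plane x y\<close> at once.
\<close>
lemma upper_triangular_involution_step:
  assumes two: "(2 :: 'a::field) \<noteq> 0" and "j ^ 2 = - 1" and "y \<noteq> 0"
  shows "(mat2 j (- (2 * j * x)) 0 (- j), half_plane x y) \<in> (sign_commuting :: ('a ^ 2 ^ 2) rel)"
proof -
  have "2 * j * (x / y) + - (2 * j * x) * (1 / y) + - (x ^ 2 + y ^ 2) / y * 0 = 0" by simp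
  from orthogonal_involutions_anticommute[OF this]
  have "mat2 j (- (2 * j * x)) 0 (- j) ** half_plane x y =
      - (half_plane x y ** mat2 j (- (2 * j * x)) 0 (- j))"
    unfolding half_plane_def .
  moreover have "mat2 j (- (2 * j * x)) 0 (- j) \<in> involutions_SL2"
    using assms(2) by (simp add: mat2_involution_iff)
  ultimately show ?thesis
    using assms(3)
    by (simp add: sign_commuting_def involutions_SL2_nonscalar[OF two] half_plane_involution)
qed

text \<open>
  The factorization \<open>s\<^sup>2 + s'\<^sup>2 = (s + j s') (s - j s')\<close> parametrizes the solutions by one nonzero
  element \<open>m\<close>; a coordinate vanishes only for \<open>m\<^sup>4 = 1\<close>. In the field with five elements every
  nonzero \<open>m\<close> has this property, and indeed \<open>PSL(2, 5)\<close> behaves differently.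
\<close>
lemma minus_1_sum_of_nonzero_squares:
  fixes j :: "'a::{field, finite}"
  assumes two: "(2 :: 'a) \<noteq> 0" and j: "j ^ 2 = - 1" and q: "5 < CARD('a)"
  obtains s s' :: 'a where "s \<noteq> 0" and "s' \<noteq> 0" and "s ^ 2 + s' ^ 2 = - 1"
proof -
  have "0 < (4 :: nat)" "4 < CARD('a) - 1" using q by simp_all
  then obtain m :: 'a where m: "m \<noteq> 0" "m ^ 4 \<noteq> 1" by (rule exists_power_ne_1)
  have m4: "m ^ 4 = m ^ 2 * m ^ 2" by (simp flip: power_add)
  show thesis
  proof (rule that[of "(m - 1 / m) / 2" "j * (m + 1 / m) / 2"])
    show "(m - 1 / m) / 2 \<noteq> 0"
    proof
      assume "(m - 1 / m) / 2 = 0"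
      then have "m ^ 2 = 1" using two m(1) by (simp add: field_simps power2_eq_square)
      then show False using m(2) m4 by simp
    qed
    show "j * (m + 1 / m) / 2 \<noteq> 0"
    proof
      assume "j * (m + 1 / m) / 2 = 0"
      moreover have "j \<noteq> 0" using j by auto
      ultimately have "m + 1 / m = 0" using two by simp
      then have "m ^ 2 = - 1"
        using m(1) by (simp add: field_simps power2_eq_square eq_neg_iff_add_eq_0)
      then show False using m(2) m4 by simp
    qed
    have "((m - 1 / m) / 2) ^ 2 + (j * (m + 1 / m) / 2) ^ 2 =
        ((m - 1 / m) ^ 2 + j ^ 2 * (m + 1 / m) ^ 2) / 4"
      by (simp add: power_divide power_mult_distrib add_divide_distrib)
    also have "\<dots> = - 4 / 4"
      using m(1) unfolding j by (simp add: field_simps power2_eq_square)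
    also have "\<dots> = - 1"
    proof -
      have "(4 :: 'a) = 2 * 2" by simp
      then have "(4 :: 'a) \<noteq> 0" using two by (metis mult_eq_0_iff)
      then show ?thesis by simp
    qed
    finally show "((m - 1 / m) / 2) ^ 2 + (j * (m + 1 / m) / 2) ^ 2 = - 1" .
  qed
qed

text \<open>
  Through the upper triangular involution that fixes \<open>x\<close>, all \<open>half_plane x y\<close> with the same
  \<open>x\<close> are connected. To change \<open>x\<close> to \<open>x' = x - d\<close>, scale a representation of \<open>- 1\<close> as a sum of two
  nonzero squares by \<open>d\<close>.
\<close>
lemma involutions_connected_1_mod_4:
  assumes q: "CARD('a::{field, finite}) mod 4 = 1" and "5 < CARD('a)"
    and "A \<in> involutions_SL2" and "B \<in> involutions_SL2"
  shows "(A, B :: 'a ^ 2 ^ 2) \<in> sign_commuting\<^sup>*"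
proof -
  have two: "(2 :: 'a) \<noteq> 0"
    by (rule two_ne_0_if_card_odd) (use q in presburger)
  obtain j :: 'a where j: "j ^ 2 = - 1" by (rule exists_sqrt_minus_1[OF q])
  obtain s s' :: 'a where s: "s \<noteq> 0" "s' \<noteq> 0" "s ^ 2 + s' ^ 2 = - 1"
    by (rule minus_1_sum_of_nonzero_squares[OF two j assms(2)])
  have vertical: "(half_plane x y, half_plane x y') \<in> sign_commuting\<^sup>*"
    if "y \<noteq> 0" "y' \<noteq> 0" for x y y' :: 'a
    using upper_triangular_involution_step[OF two j] sign_commuting_sym that
    by (meson converse_rtrancl_into_rtrancl r_into_rtrancl)
  have half_planes: "(half_plane x y, half_plane x' y') \<in> sign_commuting\<^sup>*"
    if "y \<noteq> 0" "y' \<noteq> 0" for x y x' y' :: 'a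
  proof (cases "x = x'")
    case True
    then show ?thesis using vertical that by simp
  next
    case False
    define d where "d = x - x'"
    have d: "d \<noteq> 0" using False by (simp add: d_def)
    have "(half_plane x y, half_plane x (d * s)) \<in> sign_commuting\<^sup>*"
      using vertical that d s by simp
    also have "(half_plane x (d * s), half_plane x' (d * s')) \<in> sign_commuting"
    proof (rule half_plane_step[OF two])
      have "(x - x') ^ 2 + (d * s) ^ 2 + (d * s') ^ 2 = d ^ 2 * (1 + (s ^ 2 + s' ^ 2))"
        unfolding d_def[symmetric] by (simp add: algebra_simps power_mult_distrib)
      then show "(x - x') ^ 2 + (d * s) ^ 2 + (d * s') ^ 2 = 0" by (simp add: s(3))
    qed (use d s in simp_all)
    also have "(half_plane x' (d * s'), half_plane x' y') \<in> sign_commuting\<^sup>*"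
      using vertical that d s by simp
    finally show ?thesis .
  qed
  have "\<exists>x y. y \<noteq> 0 \<and> (C, half_plane x y) \<in> sign_commuting\<^sup>*"
    if "C \<in> involutions_SL2" for C :: "'a ^ 2 ^ 2"
  proof -
    obtain a b c where C: "C = mat2 a b c (- a)" "a ^ 2 + b * c = - 1"
      by (rule involution_mat2[OF \<open>C \<in> involutions_SL2\<close>])
    show ?thesis
    proof (cases "c = 0")
      case True
      then have a: "a ^ 2 = - 1" using C(2) by simp
      then have "a \<noteq> 0" by auto
      then have "C = mat2 a (- (2 * a * (- (b / (2 * a))))) 0 (- a)"
        using C(1) True two by simp
      then have "(C, half_plane (- (b / (2 * a))) 1) \<in> sign_commuting"
        using upper_triangular_involution_step[OF two a, of 1 "- (b / (2 * a))"] by simp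
      then show ?thesis by (meson r_into_rtrancl one_neq_zero)
    next
      case False
      then have "C = half_plane (a / c) (1 / c)" "1 / c \<noteq> 0"
        using involution_half_plane that C(1) by (blast, simp)
      then show ?thesis by blast
    qed
  qed
  then obtain x y x' y' where "y \<noteq> 0" "(A, half_plane x y) \<in> sign_commuting\<^sup>*"
      "y' \<noteq> 0" "(B, half_plane x' y') \<in> sign_commuting\<^sup>*"
    using assms(3,4) by metis
  then show ?thesis
    using half_planes sign_commuting_rtrancl_sym by (meson rtrancl_trans)
qed

section \<open>Counting the components\<close>

definition involution_points :: "('a::field \<times> 'a \<times> 'a) set set" where
  "involution_points = (\<lambda>A. point (dir A)) ` involutions_SL2"

text \<open>
  For \<open>c \<noteq> 0\<close> the equation \<open>a\<^sup>2 + b c = - 1\<close> determines \<open>b\<close>; for \<open>c = 0\<close> it leaves \<open>b\<close> free and makes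
  \<open>a\<close> a square root of \<open>- 1\<close>.
\<close>
lemma card_involutions_SL2:
  "card (involutions_SL2 :: ('a::{field, finite} ^ 2 ^ 2) set) =
     CARD('a) * (CARD('a) - 1) + CARD('a) * card {j :: 'a. j ^ 2 = - 1}"
proof -
  let ?U = "(\<lambda>(a, c). mat2 a (- (a ^ 2 + 1) / c) c (- a)) ` (UNIV \<times> (UNIV - {0 :: 'a}))"
  let ?V = "(\<lambda>(b, a). mat2 a b 0 (- a)) ` (UNIV \<times> {j :: 'a. j ^ 2 = - 1})"
  have "involutions_SL2 = ?U \<union> ?V"
  proof (intro equalityI subsetI)
    fix A :: "'a ^ 2 ^ 2"
    assume "A \<in> involutions_SL2"
    then obtain a b c where A: "A = mat2 a b c (- a)" "a ^ 2 + b * c = - 1" by (rule involution_mat2)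
    show "A \<in> ?U \<union> ?V"
    proof (cases "c = 0")
      case True
      then show ?thesis using A by force
    next
      case False
      then have "b = - (a ^ 2 + 1) / c" using A(2) by (simp add: field_simps)
      then show ?thesis using A(1) False by force
    qed
  qed (auto simp: mat2_involution_iff split: if_splits)
  moreover have "card (?U \<union> ?V) = card ?U + card ?V" by (rule card_Un_disjoint) auto
  moreover have "card ?U = CARD('a) * (CARD('a) - 1)"
    by (subst card_image) (auto simp: inj_on_def card_cartesian_product card_Diff_singleton)
  moreover have "card ?V = CARD('a) * card {j :: 'a. j ^ 2 = - 1}"
    by (subst card_image) (auto simp: inj_on_def card_cartesian_product)
  ultimately show ?thesis by (simp only:)
qed

text \<open>
  An involution of \<open>PSL(2, q)\<close> is determined by its point: proportional traceless matrices
  \<open>A\<close> and \<open>t A\<close> of determinant one satisfy \<open>t\<^sup>2 = 1\<close>.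
\<close>
lemma card_involution_points:
  assumes two: "(2 :: 'a::{field, finite}) \<noteq> 0"
  shows "2 * card (involution_points :: ('a \<times> 'a \<times> 'a) set set) =
    CARD('a) * (CARD('a) - 1) + CARD('a) * card {j :: 'a. j ^ 2 = - 1}"
proof -
  have "card (involutions_SL2 :: ('a ^ 2 ^ 2) set) =
      2 * card (involution_points :: ('a \<times> 'a \<times> 'a) set set)"
    unfolding involution_points_def
  proof (rule card_fibres)
    fix A :: "'a ^ 2 ^ 2"
    assume A: "A \<in> involutions_SL2"
    then obtain a b c where abc: "A = mat2 a b c (- a)" "a ^ 2 + b * c = - 1"
      by (rule involution_mat2)
    have "B = A \<or> B = - A" if B: "B \<in> involutions_SL2" "point (dir B) = point (dir A)" for B
    proof -
      obtain a' b' c' where abc': "B = mat2 a' b' c' (- a')" "a' ^ 2 + b' * c' = - 1"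
        using B(1) by (rule involution_mat2)
      have "dir B \<in> point (dir A)" using B(2) by (metis point_eq_iff)
      then obtain t where t: "2 * a' = t * (2 * a)" "b' = t * b" "c' = t * c"
        by (auto simp: abc(1) abc'(1) mem_point_iff)
      have "2 * a' = 2 * (t * a)" using t(1) by (simp add: ac_simps)
      then have a': "a' = t * a" using two by (metis mult_cancel_left)
      have "- 1 = t ^ 2 * (a ^ 2 + b * c)"
        using abc'(2) by (simp add: a' t(2,3) algebra_simps power2_eq_square)
      then have "t ^ 2 = 1" by (simp add: abc(2))
      then have "t = 1 \<or> t = - 1" by (simp add: power2_eq_1_iff)
      then show ?thesis using abc(1) abc'(1) a' t(2,3) by auto
    qed
    moreover have "- A \<in> involutions_SL2" using abc by (simp add: mat2_involution_iff)
    ultimately have "{B \<in> involutions_SL2. point (dir B) = point (dir A)} = {A, - A}"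
      using A by (auto simp: point_uminus)
    moreover have "A \<noteq> - A"
    proof
      assume "A = - A"
      then have "a + a = 0" "b + b = 0" by (auto simp: abc(1) eq_neg_iff_add_eq_0)
      then have "2 * a = 0" "2 * b = 0" by (simp_all only: mult_2)
      then have "a = 0" "b = 0" using two by simp_all
      then show False using abc(2) by simp
    qed
    ultimately show "card {B \<in> involutions_SL2. point (dir B) = point (dir A)} = 2" by simp
  qed simp
  then show ?thesis by (simp add: card_involutions_SL2)
qed

text \<open>
  If \<open>2 = 0\<close>, then anticommuting matrices commute, and the components are the points of the plane.
\<close>
lemma kappa_PSL2_even:
  assumes "even CARD('a::{field, finite})" and "CARD('a) \<noteq> 2"
  shows "kappa (PSL :: ('a ^ 2 ^ 2) set monoid) = CARD('a) ^ 2 + CARD('a) + 1"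
proof -
  have two: "(2 :: 'a) = 0" by (rule two_eq_0_if_card_even[OF assms(1)])
  have neg: "- A = A" for A :: "'a ^ 2 ^ 2"
  proof -
    have "x + x = 0" for x :: 'a using two by (simp flip: mult_2)
    then have "- x = x" for x :: 'a by (simp add: minus_unique)
    then show ?thesis by (cases A rule: mat2_exhaust) simp
  qed
  have card: "card ((\<lambda>A. point (dir A)) ` (nonscalar_SL2 :: ('a ^ 2 ^ 2) set)) =
      CARD('a) ^ 2 + CARD('a) + 1"
    by (simp add: points_of_nonscalar_SL2_even[OF assms] card_plane_points)
  have "kappa (PSL :: ('a ^ 2 ^ 2) set monoid) =
      card ((\<lambda>A. point (dir A)) ` (nonscalar_SL2 :: ('a ^ 2 ^ 2) set))"
  proof (rule kappa_PSL2_eq_card_invariant)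
    show "point (dir A) = point (dir B)" if "(A, B) \<in> sign_commuting" for A B :: "'a ^ 2 ^ 2"
      using that commute_iff_same_point by (auto simp: sign_commuting_def neg)
    show "(A, B) \<in> sign_commuting\<^sup>*"
      if "A \<in> nonscalar_SL2" "B \<in> nonscalar_SL2" "point (dir A) = point (dir B)" for A B :: "'a ^ 2 ^ 2"
      using same_point_sign_commuting[OF that] by blast
  qed (simp_all add: point_uminus card)
  then show ?thesis by (simp add: card)
qed

text \<open>
  The components are the points of the plane, except that all points of involutions form one
  component, represented by the value \<open>{}\<close> of the invariant. The assertion is
  \<open>\<kappa> = (q\<^sup>2 + q + 1) - (q (q - 1) + r q) / 2 + 1\<close> with the denominator and the subtractions cleared.
  The bound on \<open>r\<close> ensures that there are at least two components.
\<close>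
lemma kappa_PSL2_odd:
  assumes two: "(2 :: 'a::{field, finite}) \<noteq> 0" and q: "3 < CARD('a)"
    and conn: "\<And>A B :: 'a ^ 2 ^ 2. A \<in> involutions_SL2 \<Longrightarrow> B \<in> involutions_SL2 \<Longrightarrow>
      (A, B) \<in> sign_commuting\<^sup>*"
    and r: "card {j :: 'a. j ^ 2 = - 1} = r" and "r \<le> 2"
  shows "2 * kappa (PSL :: ('a ^ 2 ^ 2) set monoid) + r * CARD('a) =
    CARD('a) ^ 2 + 3 * CARD('a) + 4"
proof -
  let ?S = "involution_points :: ('a \<times> 'a \<times> 'a) set set"
  define f where "f A = (if point (dir A) \<in> ?S then {} else point (dir A))" for A
  have S_sub: "?S \<subseteq> plane_points"
    using points_of_nonscalar_subset involutions_SL2_nonscalar[OF two]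
    unfolding involution_points_def by blast
  have S_card: "2 * card ?S = CARD('a) * (CARD('a) - 1) + CARD('a) * r"
    using card_involution_points[OF two] by (simp add: r)
  have "card ?S \<noteq> 0" using S_card q by (intro notI) simp
  then have "?S \<noteq> {}" by auto
  then obtain P where P: "P \<in> ?S" by blast
  have "f ` (nonscalar_SL2 :: ('a ^ 2 ^ 2) set) =
      (\<lambda>Q. if Q \<in> ?S then {} else Q) ` plane_points"
    unfolding points_of_nonscalar_SL2_odd[OF two q, symmetric] image_image f_def ..
  also have "\<dots> = insert {} (plane_points - ?S)"
    using P S_sub by (auto split: if_splits intro: rev_image_eqI)
  finally have image: "f ` (nonscalar_SL2 :: ('a ^ 2 ^ 2) set) = insert {} (plane_points - ?S)" .
  have "{} \<notin> (plane_points :: ('a \<times> 'a \<times> 'a) set set)"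
    using mem_point by (auto simp: plane_points_def)
  then have "card (insert {} (plane_points - ?S)) = CARD('a) ^ 2 + CARD('a) + 1 - card ?S + 1"
    using S_sub by (simp add: card_Diff_subset card_plane_points)
  moreover have "card ?S \<le> CARD('a) ^ 2 + CARD('a) + 1"
    using card_mono[OF _ S_sub] by (simp add: card_plane_points)
  ultimately have card: "card (f ` (nonscalar_SL2 :: ('a ^ 2 ^ 2) set)) + card ?S =
      CARD('a) ^ 2 + CARD('a) + 2"
    unfolding image by simp
  have sq: "CARD('a) * (CARD('a) - 1) + CARD('a) = CARD('a) ^ 2"
  proof -
    obtain n where "CARD('a) = Suc n" using q by (cases "CARD('a)") auto
    then show ?thesis by (simp add: power2_eq_square)
  qed
  have total: "2 * card (f ` (nonscalar_SL2 :: ('a ^ 2 ^ 2) set)) + r * CARD('a) =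
      CARD('a) ^ 2 + 3 * CARD('a) + 4"
    using card S_card sq by (simp add: mult.commute)
  have "r * CARD('a) \<le> 2 * CARD('a)" using \<open>r \<le> 2\<close> by simp
  with total q have two_values: "1 < card (f ` (nonscalar_SL2 :: ('a ^ 2 ^ 2) set))" by linarith
  have f_involution: "f A = {}" if "A \<in> involutions_SL2" for A
    using that by (auto simp: f_def involution_points_def)
  have to_involution: "\<exists>A' \<in> involutions_SL2. (A, A') \<in> sign_commuting"
    if "A \<in> nonscalar_SL2" "f A = {}" for A
  proof -
    have "point (dir A) \<in> ?S"
      using that(2) mem_point[of "dir A"] by (auto simp: f_def split: if_splits)
    then obtain A' where "A' \<in> involutions_SL2" "point (dir A) = point (dir A')"
      by (auto simp: involution_points_def)
    then show ?thesis
      using same_point_sign_commuting[OF that(1)] involutions_SL2_nonscalar[OF two] by blast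
  qed
  have "kappa (PSL :: ('a ^ 2 ^ 2) set monoid) = card (f ` (nonscalar_SL2 :: ('a ^ 2 ^ 2) set))"
  proof (rule kappa_PSL2_eq_card_invariant)
    show "f (- A) = f A" for A by (simp add: f_def point_uminus)
    show "f A = f B" if AB: "(A, B) \<in> sign_commuting" for A B :: "'a ^ 2 ^ 2"
    proof (cases "A ** B = B ** A")
      case True
      then show ?thesis
        using AB commute_iff_same_point[of A B] by (auto simp: sign_commuting_def f_def)
    next
      case False
      then have "A ** B = - (B ** A)" "det A = 1" "det B = 1"
        using AB by (auto simp: sign_commuting_def nonscalar_SL2_def)
      moreover from this have "B ** A = - (A ** B)" by simp
      ultimately have "A \<in> involutions_SL2" "B \<in> involutions_SL2"
        using anticommuting_imp_involution[OF two] by blast+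
      then show ?thesis by (simp add: f_involution)
    qed
    show "(A, B) \<in> sign_commuting\<^sup>*"
      if "A \<in> nonscalar_SL2" "B \<in> nonscalar_SL2" "f A = f B" for A B :: "'a ^ 2 ^ 2"
    proof (cases "f A = {}")
      case True
      obtain A' where A': "A' \<in> involutions_SL2" "(A, A') \<in> sign_commuting"
        using to_involution[OF \<open>A \<in> nonscalar_SL2\<close> True] by blast
      obtain B' where B': "B' \<in> involutions_SL2" "(B, B') \<in> sign_commuting"
        using to_involution[OF \<open>B \<in> nonscalar_SL2\<close>] True \<open>f A = f B\<close> by auto
      note r_into_rtrancl[OF A'(2)]
      also note conn[OF A'(1) B'(1)]
      also note r_into_rtrancl[OF sign_commuting_sym[OF B'(2)]]
      finally show ?thesis .
    next
      case False
      then have "point (dir A) = point (dir B)"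
        using that(3) by (auto simp: f_def split: if_splits)
      then show ?thesis using same_point_sign_commuting that by blast
    qed
  qed (rule two_values)
  then show ?thesis using total by simp
qed

theorem theorem6p7:
  fixes q :: nat and G :: "('a::{field, finite} ^ 2 ^ 2) set monoid"
  assumes "primepow q" and "q \<noteq> 2" and "q \<noteq> 3" and "q \<noteq> 5"
    and "CARD('a) = q"
    and "G = PSL"
  shows "(q mod 4 = 0 \<longrightarrow> kappa G = q^2 + q + 1) \<and>
         (q mod 4 = 1 \<longrightarrow> kappa G = q + (q - 1) * q div 2 + 2) \<and>
         (q mod 4 = 3 \<longrightarrow> kappa G = q + (q + 1) * q div 2 + 2)"
proof (intro conjI impI)
  have "card {0, 1 :: 'a} \<le> CARD('a)" by (rule card_mono) simp_all
  then have "2 \<le> q" using assms(5) by simp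
  {
    assume "q mod 4 = 0"
    then have "even q" by presburger
    then show "kappa G = q^2 + q + 1"
      using kappa_PSL2_even[where 'a='a] assms by simp
  next
    assume mod: "q mod 4 = 1"
    then have q: "5 < q" using \<open>2 \<le> q\<close> assms(4) by presburger
    have "odd q" using mod by presburger
    then have two: "(2 :: 'a) \<noteq> 0" using two_ne_0_if_card_odd[where 'a='a] assms(5) by simp
    obtain j :: 'a where j: "j ^ 2 = - 1"
      using exists_sqrt_minus_1[where 'a='a] mod assms(5) by auto
    have "j \<noteq> - j"
    proof
      assume "j = - j"
      then have "2 * j = 0" by (metis add.right_inverse mult_2)
      then show False using two j by auto
    qed
    moreover have "i ^ 2 = - 1 \<longleftrightarrow> i \<in> {j, - j}" for i
      using power2_eq_iff[of i j] j by simp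
    then have "{i. i ^ 2 = - 1} = {j, - j}" by blast
    ultimately have card: "card {i :: 'a. i ^ 2 = - 1} = 2" by simp
    have "2 * kappa G + 2 * q = q ^ 2 + 3 * q + 4"
      using kappa_PSL2_odd[OF two _ involutions_connected_1_mod_4 card] q mod assms(5,6) by simp
    then have "2 * kappa G = q ^ 2 + q + 4" by simp
    moreover obtain n where "q = Suc n" using q by (cases q) auto
    ultimately show "kappa G = q + (q - 1) * q div 2 + 2"
      by (simp add: power2_eq_square)
  next
    assume mod: "q mod 4 = 3"
    then have q: "3 < q" using \<open>2 \<le> q\<close> assms(3) by presburger
    have "odd q" using mod by presburger
    then have two: "(2 :: 'a) \<noteq> 0" using two_ne_0_if_card_odd[where 'a='a] assms(5) by simp
    have card: "card {i :: 'a. i ^ 2 = - 1} = 0"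
      using minus_1_nonsquare[where 'a='a] mod assms(5) by simp
    have "2 * kappa G = q ^ 2 + 3 * q + 4"
      using kappa_PSL2_odd[OF two _ involutions_connected_3_mod_4 card] q mod assms(5,6) by simp
    then show "kappa G = q + (q + 1) * q div 2 + 2"
      by (simp add: power2_eq_square)
  }
qed

end
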